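(* Let $H=\bigoplus_{i=1}^m H_i$ be the direct sum of separable real Hilbert spaces $H_1,\dots,H_m$, let $f\colon H\to\mathbb{R}$ be convex and differentiable, let $h_i\colon H_i\to\,]-\infty,+\infty]$ be proper, convex and lower semicontinuous for $i=1,\dots,m$, and set $h(x)=\sum_{i=1}^m h_i(x_i)$ and $F=f+h$. Let $\varepsilon=(\varepsilon_1,\dots,\varepsilon_m)$ be a $\{0,1\}^m$-valued random variable with $p_i:=\mathsf{P}(\varepsilon_i=1)>0$ for every $i$ and $\mathsf{P}(\varepsilon=(0,\dots,0))=0$, and let $(\varepsilon^n)_{n\in\mathbb{N}}$ be a sequence of independent copies of $\varepsilon$. Let $(\nu_i)_{1\le i\le m}\in\,]0,+\infty[^m$ be such that $$(\forall x,v\in H)\quad \mathsf{E}[f(x+\varepsilon\odot v)]\le f(x)+\mathsf{E}[\langle\nabla f(x),\varepsilon\odot v\rangle]+\frac12\sum_{i=1}^m p_i\nu_i\|v_i\|^2 .$$ Let $0<\gamma_i<2/\nu_i$ for every $i\in\{1,\dots,m\}$, let $x^0\in\operatorname{dom}h$ be deterministic, and let $(x^n)_{n\in\mathbb{N}}$ be the sequence of $H$-valued random variables defined by $$x_i^{n+1}=x_i^n+\varepsilon_i^n\big(\mathrm{prox}_{\gamma_i h_i}(x_i^n-\gamma_i\nabla_i f(x^n))-x_i^n\big),\qquad i=1,\dots,m,\ n\in\mathbb{N}.$$ Set $\delta=\max_{i}\gamma_i\nu_i$, $p_{\min}=\min_{i}p_i$, $F_*=\inf F$ and $S_*=\operatorname{argmin}F$.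 Suppose that $S_*\neq\varnothing$ and that there are a set $X\subset H$ with $\{x^n\mid n\in\mathbb{N}\}\subset X$ $\mathsf{P}$-a.s. and a constant $c>0$ such that $$(\forall x\in X)\quad \mathrm{dist}_{\Gamma^{-1}}(x,S_* )\le c\,\big\|x-\big(\mathrm{prox}_{\gamma_ih_i}(x_i-\gamma_i\nabla_if(x))\big)_{1\le i\le m}\big\|_{\Gamma^{-1}} .$$ Then, for every $n\in\mathbb{N}$, $$\mathsf{E}[F(x^n)]-F_*\le\Big(1-p_{\min}\min\Big\{1,\frac{2-\delta}{2c}\Big\}\Big)^n\big(\mathsf{E}[F(x^0)]-F_*\big).$$ Moreover, there exists a random variable $x_*$ taking values in $S_*$ such that $x^n\to x_*$ (strongly) $\mathsf{P}$-a.s. and $$\mathsf{E}[\|x^n-x_*\|_W]=O\Big(\big(1-p_{\min}\min\{1,(2-\delta)/(2c)\}\big)^{n/2}\Big).$$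
   Context: $H=\bigoplus_i H_i$ carries the inner product $\langle x,y\rangle=\sum_{i=1}^m\langle x_i,y_i\rangle$; $\nabla_i f(x)\in H_i$ is the $i$-th component of $\nabla f(x)$. For $v\in H$ and $\epsilon\in\{0,1\}^m$, $\epsilon\odot v=(\epsilon_iv_i)_{1\le i\le m}\in H$. For a proper convex lower semicontinuous function $\varphi$ on a Hilbert space, $\mathrm{prox}_\varphi(x)=\operatorname{argmin}_z\ \varphi(z)+\frac12\|x-z\|^2$. The weighted norms are $\|x\|_{\Gamma^{-1}}^2=\sum_{i=1}^m\frac1{\gamma_i}\|x_i\|^2$ and $\|x\|_W^2=\sum_{i=1}^m\frac{1}{\gamma_ip_i}\|x_i\|^2$, and $\mathrm{dist}_{\Gamma^{-1}}(x,S)=\inf_{z\in S}\|x-z\|_{\Gamma^{-1}}$. *)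

theory Defs
  imports "HOL-Probability.Probability" "HOL-Library.Landau_Symbols"
begin

text \<open>
  The Hilbert spaces \<open>H\<^sub>i\<close> may differ from each other. They are given as closed subspaces \<open>V i\<close>
  of one separable Hilbert space \<open>'a\<close> (any finite family of separable Hilbert spaces embeds
  isometrically into such a space), and functions on \<open>H\<^sub>i\<close> are only ever inspected on \<open>V i\<close>.
  The inner product of the type \<open>'a ^ 'm\<close> is the sum of the componentwise inner products.
\<close>

definition direct_sum :: "('m::finite \<Rightarrow> 'a set) \<Rightarrow> ('a ^ 'm) set" where
  "direct_sum V = {x. \<forall>i. x $ i \<in> V i}"

definition proper_on :: "'a set \<Rightarrow> ('a \<Rightarrow> ereal) \<Rightarrow> bool" where
  "proper_on S \<phi> \<longleftrightarrow> (\<forall>x\<in>S. \<phi> x \<noteq> -\<infinity>) \<and> (\<exists>x\<in>S. \<phi> x \<noteq> \<infinity>)"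

definition convex_ereal_on :: "'a::real_vector set \<Rightarrow> ('a \<Rightarrow> ereal) \<Rightarrow> bool" where
  "convex_ereal_on S \<phi> \<longleftrightarrow> convex S \<and>
     (\<forall>x\<in>S. \<forall>y\<in>S. \<forall>t\<in>{0<..<1}.
        \<phi> ((1 - t) *\<^sub>R x + t *\<^sub>R y) \<le> ereal (1 - t) * \<phi> x + ereal t * \<phi> y)"

definition lsc_on :: "'a::topological_space set \<Rightarrow> ('a \<Rightarrow> ereal) \<Rightarrow> bool" where
  "lsc_on S \<phi> \<longleftrightarrow> (\<forall>x\<in>S. \<phi> x \<le> Liminf (at x within S) \<phi>)"

definition argmin_set :: "('a \<Rightarrow> ereal) \<Rightarrow> 'a set \<Rightarrow> 'a set" where
  "argmin_set \<phi> S = {x. is_arg_min \<phi> (\<lambda>z. z \<in> S) x}"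

definition prox :: "'a::real_normed_vector set \<Rightarrow> ('a \<Rightarrow> ereal) \<Rightarrow> 'a \<Rightarrow> 'a" where
  "prox S \<phi> x = arg_min_on (\<lambda>z. \<phi> z + ereal (1 / 2 * (norm (x - z))\<^sup>2)) S"

definition block_select :: "('m::finite \<Rightarrow> bool) \<Rightarrow> 'a::real_vector ^ 'm \<Rightarrow> 'a ^ 'm" (infixr "\<odot>" 75)
  where "e \<odot> v = (\<chi> i. of_bool (e i) *\<^sub>R v $ i)"

definition wnorm :: "('m::finite \<Rightarrow> real) \<Rightarrow> 'a::real_normed_vector ^ 'm \<Rightarrow> real" where
  "wnorm w x = sqrt (\<Sum>i\<in>UNIV. w i * (norm (x $ i))\<^sup>2)"

definition wdist :: "('m::finite \<Rightarrow> real) \<Rightarrow> 'a::real_normed_vector ^ 'm \<Rightarrow> ('a ^ 'm) set \<Rightarrow> real" where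
  "wdist w x S = (INF z\<in>S. wnorm w (x - z))"

definition separable_sum :: "('m::finite \<Rightarrow> 'a \<Rightarrow> ereal) \<Rightarrow> 'a ^ 'm \<Rightarrow> ereal" where
  "separable_sum h x = (\<Sum>i\<in>UNIV. h i (x $ i))"

definition fb_step ::
  "('m::finite \<Rightarrow> 'a::real_normed_vector set) \<Rightarrow> ('m \<Rightarrow> 'a \<Rightarrow> ereal) \<Rightarrow> ('a ^ 'm \<Rightarrow> 'a ^ 'm)
    \<Rightarrow> ('m \<Rightarrow> real) \<Rightarrow> 'a ^ 'm \<Rightarrow> 'a ^ 'm" where
  "fb_step V h grad \<gamma> x =
     (\<chi> i. prox (V i) (\<lambda>z. ereal (\<gamma> i) * h i z) (x $ i - \<gamma> i *\<^sub>R grad x $ i))"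

definition ereal_expectation :: "'w measure \<Rightarrow> ('w \<Rightarrow> ereal) \<Rightarrow> ereal" where
  "ereal_expectation M Y =
     enn2ereal (\<integral>\<^sup>+ \<omega>. e2ennreal (Y \<omega>) \<partial>M) - enn2ereal (\<integral>\<^sup>+ \<omega>. e2ennreal (- Y \<omega>) \<partial>M)"

end

theory Submission
  imports Defs
begin

text \<open>
  Each iterate depends on finitely many of the \<open>\<epsilon>\<^sup>k\<close>, hence takes finitely many values; conditional
  expectations are iterated integrals and the proximity operators need not be measurable.

  Let \<open>y\<close> be the forward-backward step of \<open>x\<close>, \<open>v = y - x\<close>, \<open>D = \<parallel>v\<parallel>\<close> in the \<open>\<Gamma>\<^sup>-\<^sup>1\<close>-norm,
  \<open>a = (2 - \<delta>) / 2\<close>, and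
  \<open>B\<^sub>i = h\<^sub>i(y\<^sub>i) - h\<^sub>i(x\<^sub>i) + \<langle>\<nabla>\<^sub>i f(x), v\<^sub>i\<rangle> + (\<nu>\<^sub>i / 2) \<parallel>v\<^sub>i\<parallel>\<^sup>2\<close>.
  Smoothness gives \<open>E F(x\<^sup>+) \<le> F(x) + \<Sum> p\<^sub>i B\<^sub>i\<close>. The variational inequality of the proximity
  operator, tested at \<open>x\<close>, shows that every \<open>B\<^sub>i\<close> is nonpositive and \<open>\<Sum> B\<^sub>i \<le> - a D\<^sup>2\<close>; tested at
  minimizers it gives \<open>\<Sum> B\<^sub>i \<le> F\<^sub>* - F(x) + D dist(x, S\<^sub>*) - a D\<^sup>2 \<le> F\<^sub>* - F(x) + (c - a) D\<^sup>2\<close>.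
  A convex combination of the two bounds eliminates \<open>D\<close> and yields the rate.

  For the iterates, \<open>E \<parallel>x\<^sup>+ - x\<parallel>\<^sup>2 = D\<^sup>2\<close> in the \<open>W\<close>-norm, and \<open>a p\<^sub>m\<^sub>i\<^sub>n D\<^sup>2 \<le> F(x) - E F(x\<^sup>+)\<close>, so the
  expected increments decay like \<open>rate\<^sup>n\<^sup>/\<^sup>2\<close> and are summable. Almost surely the
  sequence is therefore Cauchy, and its limit is a minimizer by lower semicontinuity of \<open>F\<close>.
\<close>

section \<open>Lower semicontinuous functions\<close>

lemma lsc_onI:
  fixes S :: "'a::first_countable_topology set"
  assumes "\<And>u z. \<lbrakk>\<And>n. u n \<in> S; z \<in> S; u \<longlonglongrightarrow> z\<rbrakk> \<Longrightarrow> \<phi> z \<le> liminf (\<lambda>n. \<phi> (u n))"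
  shows "lsc_on S \<phi>"
proof -
  have "\<forall>\<^sub>F x in at z within S. b < \<phi> x" if "z \<in> S" "b < \<phi> z" for z b
    using assms that by (intro sequentially_imp_eventually_within) (auto simp: le_Liminf_iff)
  then show ?thesis
    by (simp add: lsc_on_def le_Liminf_iff)
qed

lemma lsc_onD:
  assumes lsc: "lsc_on S \<phi>" and "\<And>n. u n \<in> S" "z \<in> S" "u \<longlonglongrightarrow> z"
  shows "\<phi> z \<le> liminf (\<lambda>n. \<phi> (u n))"
  unfolding le_Liminf_iff
proof safe
  fix b assume "b < \<phi> z"
  then have "\<forall>\<^sub>F x in at z within S. b < \<phi> x"
    using lsc \<open>z \<in> S\<close> by (auto simp: lsc_on_def le_Liminf_iff)
  then have "\<forall>\<^sub>F x in nhds z. x \<in> S \<longrightarrow> b < \<phi> x"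
    unfolding eventually_at_filter by eventually_elim (use \<open>b < \<phi> z\<close> in metis)
  then have "\<forall>\<^sub>F n in sequentially. u n \<in> S \<longrightarrow> b < \<phi> (u n)"
    using \<open>u \<longlonglongrightarrow> z\<close> by (rule eventually_compose_filterlim)
  then show "\<forall>\<^sub>F n in sequentially. b < \<phi> (u n)"
    using assms(2) by simp
qed

lemma lsc_onD_tendsto:
  assumes "lsc_on S \<phi>" "\<And>n. u n \<in> S" "z \<in> S" "u \<longlonglongrightarrow> z" "(\<lambda>n. \<phi> (u n)) \<longlonglongrightarrow> l"
  shows "\<phi> z \<le> l"
  using lsc_onD[OF assms(1-4)] lim_imp_Liminf[OF _ assms(5)] by simp

lemma lsc_on_local_lower_bound:
  fixes y :: "'a::metric_space"
  assumes lsc: "lsc_on S \<phi>" and "y \<in> S" "a < \<phi> y"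
  obtains r where "0 < r" "\<And>z. z \<in> S \<Longrightarrow> dist z y < r \<Longrightarrow> a < \<phi> z"
proof -
  have "\<forall>\<^sub>F z in at y within S. a < \<phi> z"
    using assms by (auto simp: lsc_on_def le_Liminf_iff)
  then obtain r where "0 < r" "\<And>z. z \<in> S \<Longrightarrow> z \<noteq> y \<Longrightarrow> dist z y < r \<Longrightarrow> a < \<phi> z"
    by (auto simp: eventually_at)
  then show ?thesis
    using that \<open>a < \<phi> y\<close> by metis
qed

lemma lsc_on_continuous:
  fixes S :: "'a::first_countable_topology set"
  assumes "continuous_on S g"
  shows "lsc_on S (\<lambda>z. ereal (g z))"
proof (rule lsc_onI)
  fix u z assume "\<And>n. u n \<in> S" "z \<in> S" "u \<longlonglongrightarrow> z"
  then have "(\<lambda>n. ereal (g (u n))) \<longlonglongrightarrow> ereal (g z)"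
    using continuous_on_tendsto_compose[OF assms, of u z sequentially] by simp
  then show "ereal (g z) \<le> liminf (\<lambda>n. ereal (g (u n)))"
    by (metis lim_imp_Liminf order_refl trivial_limit_sequentially)
qed

lemma lsc_on_compose:
  fixes T :: "'b::first_countable_topology set"
  assumes "lsc_on S \<phi>" "continuous_on T g" "g \<in> T \<rightarrow> S"
  shows "lsc_on T (\<lambda>z. \<phi> (g z))"
proof (rule lsc_onI)
  fix u z assume u: "\<And>n. u n \<in> T" "z \<in> T" "u \<longlonglongrightarrow> z"
  then have "(\<lambda>n. g (u n)) \<longlonglongrightarrow> g z"
    using continuous_on_tendsto_compose[OF assms(2), of u z sequentially] by simp
  then show "\<phi> (g z) \<le> liminf (\<lambda>n. \<phi> (g (u n)))"
    using u assms(3) by (intro lsc_onD[OF assms(1)]) auto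
qed

lemma lsc_on_add:
  fixes S :: "'a::first_countable_topology set"
  assumes lsc: "lsc_on S \<phi>" "lsc_on S \<psi>"
    and not_MInf: "\<And>z. z \<in> S \<Longrightarrow> \<phi> z \<noteq> -\<infinity>" "\<And>z. z \<in> S \<Longrightarrow> \<psi> z \<noteq> -\<infinity>"
  shows "lsc_on S (\<lambda>z. \<phi> z + \<psi> z)"
proof (rule lsc_onI)
  fix u z assume u: "\<And>n. u n \<in> S" "z \<in> S" "u \<longlonglongrightarrow> z"
  note liminfs = lsc_onD[OF lsc(1) u] lsc_onD[OF lsc(2) u]
  then have "\<phi> z + \<psi> z \<le> liminf (\<lambda>n. \<phi> (u n)) + liminf (\<lambda>n. \<psi> (u n))"
    by (rule add_mono)
  also have "\<dots> \<le> liminf (\<lambda>n. \<phi> (u n) + \<psi> (u n))"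
    using liminfs not_MInf[OF u(2)] by (intro ereal_liminf_add_mono) auto
  finally show "\<phi> z + \<psi> z \<le> liminf (\<lambda>n. \<phi> (u n) + \<psi> (u n))" .
qed

lemma lsc_on_sum:
  fixes S :: "'a::first_countable_topology set"
  assumes "finite I" "\<And>i. i \<in> I \<Longrightarrow> lsc_on S (\<phi> i)" "\<And>i z. i \<in> I \<Longrightarrow> z \<in> S \<Longrightarrow> \<phi> i z \<noteq> -\<infinity>"
  shows "lsc_on S (\<lambda>z. \<Sum>i\<in>I. \<phi> i z)"
  using assms
proof (induction I rule: finite_induct)
  case empty
  then show ?case
    using lsc_on_continuous[of S "\<lambda>_. 0"] by (simp add: zero_ereal_def)
next
  case (insert j I)
  have "(\<Sum>i\<in>I. \<phi> i z) \<noteq> -\<infinity>" if "z \<in> S" for z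
    using insert.hyps(1) insert.prems(2) that by (induction I rule: finite_induct) auto
  then show ?case
    using insert by (auto intro!: lsc_on_add)
qed

lemma lsc_on_scale:
  assumes "lsc_on S \<phi>" "0 \<le> c"
  shows "lsc_on S (\<lambda>z. ereal c * \<phi> z)"
  unfolding lsc_on_def
proof
  fix z assume z: "z \<in> S"
  show "ereal c * \<phi> z \<le> Liminf (at z within S) (\<lambda>z. ereal c * \<phi> z)"
  proof (cases "at z within S = bot")
    case False
    then show ?thesis
      using assms z by (simp add: Liminf_ereal_mult_left lsc_on_def ereal_mult_left_mono)
  qed simp
qed

section \<open>Convex functions\<close>

definition effective_domain :: "'a set \<Rightarrow> ('a \<Rightarrow> ereal) \<Rightarrow> 'a set" where
  "effective_domain S \<phi> = {z \<in> S. \<phi> z \<noteq> \<infinity>}"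

lemma ereal_real_effective_domain:
  assumes "proper_on S \<phi>" "z \<in> effective_domain S \<phi>"
  shows "ereal (real_of_ereal (\<phi> z)) = \<phi> z"
  using assms by (auto simp: proper_on_def effective_domain_def ereal_real)

lemma proper_on_scale:
  assumes "proper_on S \<phi>" "0 < c"
  shows "proper_on S (\<lambda>z. ereal c * \<phi> z)"
  using assms by (auto simp: proper_on_def)

lemma effective_domain_scale:
  "0 < c \<Longrightarrow> effective_domain S (\<lambda>z. ereal c * \<phi> z) = effective_domain S \<phi>"
  by (auto simp: effective_domain_def)

lemma convex_ereal_on_scale:
  assumes "convex_ereal_on S \<phi>" "0 < c"
  shows "convex_ereal_on S (\<lambda>z. ereal c * \<phi> z)"
  unfolding convex_ereal_on_def
proof (intro conjI ballI)
  show "convex S"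
    using assms by (simp add: convex_ereal_on_def)
  fix x y and t :: real assume xy: "x \<in> S" "y \<in> S" and t: "t \<in> {0<..<1}"
  have "ereal c * \<phi> ((1 - t) *\<^sub>R x + t *\<^sub>R y) \<le> ereal c * (ereal (1 - t) * \<phi> x + ereal t * \<phi> y)"
    using assms xy t by (intro ereal_mult_left_mono) (auto simp: convex_ereal_on_def)
  also have "\<dots> = ereal (1 - t) * (ereal c * \<phi> x) + ereal t * (ereal c * \<phi> y)"
    using t assms(2) by (cases "\<phi> x"; cases "\<phi> y") (auto simp: algebra_simps)
  finally show "ereal c * \<phi> ((1 - t) *\<^sub>R x + t *\<^sub>R y)
    \<le> ereal (1 - t) * (ereal c * \<phi> x) + ereal t * (ereal c * \<phi> y)" .
qed

lemma convex_on_effective_domain: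
  assumes "convex_ereal_on S \<phi>" "proper_on S \<phi>"
  shows "convex_on (effective_domain S \<phi>) (\<lambda>z. real_of_ereal (\<phi> z))"
proof -
  let ?D = "effective_domain S \<phi>"
  have segment: "(1 - t) *\<^sub>R x + t *\<^sub>R y \<in> ?D \<and> real_of_ereal (\<phi> ((1 - t) *\<^sub>R x + t *\<^sub>R y))
      \<le> (1 - t) * real_of_ereal (\<phi> x) + t * real_of_ereal (\<phi> y)"
    if xy: "x \<in> ?D" "y \<in> ?D" and t: "0 < t" "t < 1" for x y t
  proof -
    let ?z = "(1 - t) *\<^sub>R x + t *\<^sub>R y"
    have S: "x \<in> S" "y \<in> S" "?z \<in> S"
      using assms xy t convexD[of S x y "1 - t" t]
      by (auto simp: convex_ereal_on_def effective_domain_def)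
    obtain a b where ab: "\<phi> x = ereal a" "\<phi> y = ereal b"
      using ereal_real_effective_domain[OF assms(2)] xy by metis
    have "\<phi> ?z \<le> ereal (1 - t) * \<phi> x + ereal t * \<phi> y"
      using assms(1) S t by (simp add: convex_ereal_on_def)
    then have chord: "\<phi> ?z \<le> ereal ((1 - t) * a + t * b)"
      by (simp add: ab)
    then have "?z \<in> ?D"
      using S by (auto simp: effective_domain_def)
    with chord show ?thesis
      using ereal_real_effective_domain[OF assms(2)] ab
      by (metis ereal_less_eq(3) real_of_ereal.simps(1))
  qed
  show ?thesis
  proof (rule convex_onI)
    show "convex ?D"
      unfolding convex_alt using segment
      by (metis add.right_neutral add_0 diff_self diff_zero order_le_less scaleR_one
          scaleR_zero_left)
  qed (use segment in blast)
qed

lemma convex_ereal_on_extrapolate: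
  assumes cvx: "convex_ereal_on S \<phi>" and y: "y \<in> S" "\<phi> y = ereal b" and z: "z \<in> S"
    and t: "0 < t" "t < 1" and less: "ereal a < \<phi> ((1 - t) *\<^sub>R y + t *\<^sub>R z)"
  shows "ereal (b - (b - a) / t) \<le> \<phi> z"
proof -
  have chord: "ereal a < ereal ((1 - t) * b) + ereal t * \<phi> z"
  proof -
    have "\<phi> ((1 - t) *\<^sub>R y + t *\<^sub>R z) \<le> ereal (1 - t) * \<phi> y + ereal t * \<phi> z"
      using cvx y(1) z t unfolding convex_ereal_on_def by auto
    with less y(2) show ?thesis by (simp add: less_le_trans)
  qed
  show ?thesis
  proof (cases "\<phi> z")
    case (real s)
    then have "a < (1 - t) * b + t * s"
      using chord by simp
    then have "b - (b - a) / t \<le> s"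
      using t by (simp add: field_simps)
    then show ?thesis
      by (simp add: real)
  next
    case MInf
    then show ?thesis using chord t by simp
  qed simp
qed

text \<open>
  No separation theorem is needed: a lower bound near \<open>y\<close> propagates linearly along rays by
  convexity.
\<close>

lemma convex_lsc_linear_minorant:
  fixes S :: "'a::real_normed_vector set"
  assumes cvx: "convex_ereal_on S \<phi>" and lsc: "lsc_on S \<phi>"
    and y: "y \<in> S" "\<phi> y = ereal b" and "a < b"
  obtains K where "0 \<le> K" "\<And>z. z \<in> S \<Longrightarrow> ereal (a - K * norm (z - y)) \<le> \<phi> z"
proof -
  obtain r where r: "0 < r" "\<And>z. z \<in> S \<Longrightarrow> norm (z - y) < r \<Longrightarrow> ereal a < \<phi> z"
    using lsc_on_local_lower_bound[OF lsc y(1), of "ereal a"] y(2) \<open>a < b\<close> by (auto simp: dist_norm)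
  define K where "K = 2 * (b - a) / r"
  have K: "0 \<le> K"
    using \<open>a < b\<close> r(1) by (simp add: K_def)
  moreover have "ereal (a - K * norm (z - y)) \<le> \<phi> z" if z: "z \<in> S" for z
  proof (cases "norm (z - y) < r")
    case True
    have "ereal (a - K * norm (z - y)) \<le> ereal a"
      using K by simp
    also have "\<dots> \<le> \<phi> z"
      using r(2)[OF z True] by simp
    finally show ?thesis .
  next
    case False
    define t where "t = r / (2 * norm (z - y))"
    have t: "0 < t" "t < 1" "t * norm (z - y) = r / 2" "(b - a) / t = K * norm (z - y)"
      using False r(1) by (auto simp: t_def K_def divide_simps)
    let ?w = "(1 - t) *\<^sub>R y + t *\<^sub>R z"
    have "?w - y = t *\<^sub>R (z - y)"
      by (simp add: algebra_simps)
    then have "norm (?w - y) < r"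
      using t r(1) by simp
    moreover have "?w \<in> S"
      using cvx y z t convexD[of S y z "1 - t" t] by (simp add: convex_ereal_on_def)
    ultimately have "ereal (b - (b - a) / t) \<le> \<phi> z"
      using r(2) by (intro convex_ereal_on_extrapolate[OF cvx y z t(1,2)])
    moreover have "a - K * norm (z - y) \<le> b - (b - a) / t"
      using \<open>a < b\<close> t(4) by simp
    ultimately show ?thesis
      using order_trans ereal_less_eq(3) by blast
  qed
  ultimately show ?thesis by (rule that)
qed

lemma convex_on_ge_tangent:
  fixes f :: "'a::real_normed_vector \<Rightarrow> real"
  assumes cvx: "convex_on S f" and deriv: "(f has_derivative f') (at y within S)"
    and y: "y \<in> S" and z: "z \<in> S"
  shows "f y + f' (z - y) \<le> f z"
proof -
  define l where "l t = y + t *\<^sub>R (z - y)" for t :: real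
  have l: "l t = (1 - t) *\<^sub>R y + t *\<^sub>R z" for t
    by (simp add: l_def algebra_simps)
  have l_S: "l ` {0..1} \<subseteq> S"
    using convex_on_imp_convex[OF cvx] y z by (auto simp: l convex_alt)
  have chord: "(f (l t) - f (l 0)) / (t - 0) \<le> f z - f y" if "0 < t" "t < 1" for t
  proof -
    have "f (l t) \<le> (1 - t) * f y + t * f z"
      using convex_onD[OF cvx, of t y z] that y z by (simp add: l)
    then show ?thesis
      using that by (simp add: l_def field_simps)
  qed
  have "(l has_derivative (\<lambda>t. t *\<^sub>R (z - y))) (at 0 within {0..1})"
    unfolding l_def by (auto intro!: derivative_eq_intros)
  moreover have "(f has_derivative f') (at (l 0) within l ` {0..1})"
    using has_derivative_subset[OF deriv l_S] by (simp add: l_def)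
  ultimately have "((\<lambda>t. f (l t)) has_derivative (\<lambda>t. f' (t *\<^sub>R (z - y)))) (at 0 within {0..1})"
    by (rule has_derivative_in_compose)
  then have "((\<lambda>t. f (l t)) has_real_derivative f' (z - y)) (at 0 within {0..1})"
    using linear_scale[OF has_derivative_linear[OF deriv]]
    by (simp add: has_field_derivative_def mult_commute_abs)
  then have "((\<lambda>t. (f (l t) - f (l 0)) / (t - 0)) \<longlongrightarrow> f' (z - y)) (at_right 0)"
    unfolding has_field_derivative_iff by (simp add: at_within_Icc_at_right)
  moreover have "\<forall>\<^sub>F t in at_right 0. (f (l t) - f (l 0)) / (t - 0) \<le> f z - f y"
    using chord unfolding eventually_at_right_field by (intro exI[of _ 1]) simp
  ultimately have "f' (z - y) \<le> f z - f y"
    by (intro tendsto_upperbound) auto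
  then show ?thesis by simp
qed

section \<open>Strongly convex functions\<close>

definition strongly_convex_on :: "real \<Rightarrow> 'a::real_normed_vector set \<Rightarrow> ('a \<Rightarrow> real) \<Rightarrow> bool" where
  "strongly_convex_on \<mu> S g \<longleftrightarrow> convex S \<and>
     (\<forall>x\<in>S. \<forall>y\<in>S. \<forall>t\<in>{0<..<1}.
        g ((1 - t) *\<^sub>R x + t *\<^sub>R y)
          \<le> (1 - t) * g x + t * g y - \<mu> / 2 * (t * (1 - t)) * (norm (x - y))\<^sup>2)"

lemma strongly_convex_onD:
  assumes "strongly_convex_on \<mu> S g" "x \<in> S" "y \<in> S" "0 < t" "t < 1"
  shows "(1 - t) *\<^sub>R x + t *\<^sub>R y \<in> S"
    and "g ((1 - t) *\<^sub>R x + t *\<^sub>R y)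
          \<le> (1 - t) * g x + t * g y - \<mu> / 2 * (t * (1 - t)) * (norm (x - y))\<^sup>2"
  using assms convexD[of S x y "1 - t" t] by (auto simp: strongly_convex_on_def)

lemma strongly_convex_on_cong:
  assumes "\<And>z. z \<in> S \<Longrightarrow> g z = g' z"
  shows "strongly_convex_on \<mu> S g \<longleftrightarrow> strongly_convex_on \<mu> S g'"
  unfolding strongly_convex_on_def
  by (intro conj_cong ball_cong refl) (use assms in \<open>auto simp: convex_alt\<close>)

lemma norm_convex_combination_power2:
  fixes x y :: "'a::real_inner"
  shows "(norm ((1 - t) *\<^sub>R x + t *\<^sub>R y))\<^sup>2
    = (1 - t) * (norm x)\<^sup>2 + t * (norm y)\<^sup>2 - t * (1 - t) * (norm (x - y))\<^sup>2"
  by (simp add: power2_norm_eq_inner inner_commute algebra_simps)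

lemma strongly_convex_on_add_half_dist_power2:
  fixes u :: "'a::real_inner"
  assumes "convex_on S g"
  shows "strongly_convex_on 1 S (\<lambda>z. g z + 1 / 2 * (norm (u - z))\<^sup>2)"
  unfolding strongly_convex_on_def
proof (intro conjI ballI)
  show "convex S"
    using assms by (simp add: convex_on_def)
  fix x y and t :: real assume xy: "x \<in> S" "y \<in> S" and t: "t \<in> {0<..<1}"
  let ?z = "(1 - t) *\<^sub>R x + t *\<^sub>R y"
  have "u - ?z = (1 - t) *\<^sub>R (u - x) + t *\<^sub>R (u - y)"
    by (simp add: algebra_simps)
  then have "(norm (u - ?z))\<^sup>2
      = (1 - t) * (norm (u - x))\<^sup>2 + t * (norm (u - y))\<^sup>2 - t * (1 - t) * (norm (x - y))\<^sup>2"
    using norm_convex_combination_power2[of t "u - x" "u - y"] by (simp add: norm_minus_commute)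
  moreover have "g ?z \<le> (1 - t) * g x + t * g y"
    using convex_onD[OF assms, of t x y] xy t by simp
  ultimately show "g ?z + 1 / 2 * (norm (u - ?z))\<^sup>2
      \<le> (1 - t) * (g x + 1 / 2 * (norm (u - x))\<^sup>2) + t * (g y + 1 / 2 * (norm (u - y))\<^sup>2)
        - 1 / 2 * (t * (1 - t)) * (norm (x - y))\<^sup>2"
    by (simp add: field_simps)
qed

lemma strongly_convex_on_minimizing_sequence_Cauchy:
  assumes g: "strongly_convex_on \<mu> S g" "0 < \<mu>" and lower: "\<And>z. z \<in> S \<Longrightarrow> m \<le> g z"
    and s: "\<And>n. s n \<in> S" "(\<lambda>n. g (s n)) \<longlonglongrightarrow> m"
  shows "Cauchy s"
proof (rule metric_CauchyI)
  have close: "\<mu> / 4 * (norm (x - y))\<^sup>2 \<le> (g x - m) + (g y - m)" if "x \<in> S" "y \<in> S" for x y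
    using strongly_convex_onD[OF g(1) that, of "1 / 2"]
      lower[of "(1 - 1 / 2) *\<^sub>R x + (1 / 2) *\<^sub>R y"] by simp
  fix e :: real assume e: "0 < e"
  have "\<forall>\<^sub>F n in sequentially. g (s n) < m + \<mu> / 8 * e\<^sup>2"
    using order_tendstoD(2)[OF s(2)] g(2) e by simp
  then obtain N where N: "\<And>n. N \<le> n \<Longrightarrow> g (s n) < m + \<mu> / 8 * e\<^sup>2"
    by (auto simp: eventually_sequentially)
  have "dist (s i) (s j) < e" if "N \<le> i" "N \<le> j" for i j
  proof -
    have "\<mu> / 4 * (norm (s i - s j))\<^sup>2 < \<mu> / 4 * e\<^sup>2"
      using close[OF s(1) s(1), of i j] N[OF that(1)] N[OF that(2)] by simp
    then have "(norm (s i - s j))\<^sup>2 < e\<^sup>2"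
      using g(2) by simp
    then show ?thesis
      using e by (simp add: dist_norm power2_less_imp_less)
  qed
  then show "\<exists>N. \<forall>i\<ge>N. \<forall>j\<ge>N. dist (s i) (s j) < e" by blast
qed

lemma strongly_convex_on_growth_at_minimum:
  assumes g: "strongly_convex_on \<mu> S g" and y: "y \<in> S" and min: "\<And>z. z \<in> S \<Longrightarrow> g y \<le> g z"
    and z: "z \<in> S"
  shows "g y + \<mu> / 2 * (norm (z - y))\<^sup>2 \<le> g z"
proof -
  let ?bound = "\<lambda>t. g y + \<mu> / 2 * (1 - t) * (norm (z - y))\<^sup>2"
  have "?bound t \<le> g z" if t: "0 < t" "t < 1" for t
  proof -
    have "g y \<le> (1 - t) * g y + t * g z - \<mu> / 2 * (t * (1 - t)) * (norm (z - y))\<^sup>2"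
      using strongly_convex_onD[OF g y z t] min
      by (metis norm_minus_commute order_trans)
    then have "t * ?bound t \<le> t * g z"
      by (simp add: algebra_simps)
    then show ?thesis using t by simp
  qed
  then have "\<forall>\<^sub>F t in at_right 0. ?bound t \<le> g z"
    by (auto simp: eventually_at_right_field intro!: exI[of _ 1])
  moreover have "(?bound \<longlongrightarrow> ?bound 0) (at_right 0)"
    by (intro tendsto_intros)
  ultimately have "?bound 0 \<le> g z"
    by (intro tendsto_upperbound) auto
  then show ?thesis by simp
qed

lemma minimizing_sequence_exists:
  fixes g :: "'a \<Rightarrow> real"
  assumes "D \<noteq> {}" "bdd_below (g ` D)"
  obtains s where "\<And>n. s n \<in> D" "(\<lambda>n. g (s n)) \<longlonglongrightarrow> (INF z\<in>D. g z)"
proof -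
  have "Inf (g ` D) \<in> closure (g ` D)"
    using assms by (intro closure_contains_Inf) auto
  then obtain v where v: "\<And>n. v n \<in> g ` D" "v \<longlonglongrightarrow> Inf (g ` D)"
    unfolding closure_sequential by blast
  then have "\<forall>n. \<exists>z\<in>D. g z = v n"
    by (metis imageE)
  then obtain s where "\<And>n. s n \<in> D" "\<And>n. g (s n) = v n"
    by metis
  then show ?thesis
    using v(2) by (intro that[of s]) simp_all
qed

text \<open>The direct method: strong convexity replaces weak compactness of the sublevel sets.\<close>

lemma strongly_convex_lsc_attains_minimum:
  fixes \<phi> :: "'a::banach \<Rightarrow> ereal"
  assumes "closed S" and proper: "proper_on S \<phi>" and lsc: "lsc_on S \<phi>"
    and strong: "strongly_convex_on \<mu> (effective_domain S \<phi>) (\<lambda>z. real_of_ereal (\<phi> z))" "0 < \<mu>"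
    and lower: "\<And>z. z \<in> S \<Longrightarrow> ereal b \<le> \<phi> z"
  obtains y where "y \<in> S" "\<And>z. z \<in> S \<Longrightarrow> \<phi> y \<le> \<phi> z"
proof -
  define D where "D = effective_domain S \<phi>"
  define g where "g = (\<lambda>z. real_of_ereal (\<phi> z))"
  have D_nonempty: "D \<noteq> {}" and D_S: "D \<subseteq> S"
    using proper by (auto simp: D_def proper_on_def effective_domain_def)
  have finite_value: "\<phi> z = ereal (g z)" if "z \<in> D" for z
    using ereal_real_effective_domain[OF proper] that by (simp add: D_def g_def)
  have bdd: "bdd_below (g ` D)"
    using lower finite_value D_S by (intro bdd_belowI[of _ b]) (force simp: image_iff)
  define m where "m = (INF z\<in>D. g z)"
  have m_le: "m \<le> g z" if "z \<in> D" for z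
    using that bdd by (simp add: m_def cINF_lower)
  obtain s where s: "\<And>n. s n \<in> D" "(\<lambda>n. g (s n)) \<longlonglongrightarrow> m"
    using minimizing_sequence_exists[OF D_nonempty bdd] unfolding m_def by blast
  have "Cauchy s"
    using strong[folded D_def g_def] m_le s by (rule strongly_convex_on_minimizing_sequence_Cauchy)
  then obtain y where y: "s \<longlonglongrightarrow> y"
    by (auto simp: Cauchy_convergent_iff convergent_def)
  show ?thesis
  proof (rule that)
    show y_S: "y \<in> S"
      using closed_sequentially[OF \<open>closed S\<close> _ y] s(1) D_S by blast
    have "(\<lambda>n. \<phi> (s n)) \<longlonglongrightarrow> ereal m"
      using s by (simp add: finite_value)
    then have "\<phi> y \<le> ereal m"
      using lsc_onD_tendsto[OF lsc _ y_S y] s(1) D_S by blast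
    moreover have "ereal m \<le> \<phi> z" if "z \<in> S" for z
      using m_le[of z] finite_value[of z] that
      by (cases "z \<in> D") (auto simp: D_def effective_domain_def)
    ultimately show "\<phi> y \<le> \<phi> z" if "z \<in> S" for z
      using that order_trans by blast
  qed
qed

section \<open>Proximity operators\<close>

definition prox_objective :: "('a::real_normed_vector \<Rightarrow> ereal) \<Rightarrow> 'a \<Rightarrow> 'a \<Rightarrow> ereal" where
  "prox_objective \<phi> u z = \<phi> z + ereal (1 / 2 * (norm (u - z))\<^sup>2)"

lemma effective_domain_prox_objective:
  "effective_domain S (prox_objective \<phi> u) = effective_domain S \<phi>"
  by (simp add: effective_domain_def prox_objective_def)

lemma proper_on_prox_objective: "proper_on S \<phi> \<Longrightarrow> proper_on S (prox_objective \<phi> u)"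
  by (simp add: proper_on_def prox_objective_def)

lemma lsc_on_prox_objective:
  assumes "lsc_on S \<phi>" "proper_on S \<phi>"
  shows "lsc_on S (prox_objective \<phi> u)"
  unfolding prox_objective_def[abs_def]
  using assms by (intro lsc_on_add lsc_on_continuous continuous_intros) (auto simp: proper_on_def)

lemma real_prox_objective:
  assumes "proper_on S \<phi>" "z \<in> effective_domain S \<phi>"
  shows "real_of_ereal (prox_objective \<phi> u z) = real_of_ereal (\<phi> z) + 1 / 2 * (norm (u - z))\<^sup>2"
  using ereal_real_effective_domain[OF assms]
  by (metis plus_ereal.simps(1) prox_objective_def real_of_ereal.simps(1))

lemma strongly_convex_on_prox_objective:
  fixes u :: "'a::real_inner"
  assumes "convex_ereal_on S \<phi>" "proper_on S \<phi>"
  shows "strongly_convex_on 1 (effective_domain S (prox_objective \<phi> u))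
    (\<lambda>z. real_of_ereal (prox_objective \<phi> u z))"
  unfolding effective_domain_prox_objective
  using strongly_convex_on_add_half_dist_power2[OF convex_on_effective_domain[OF assms]]
  by (rule strongly_convex_on_cong[THEN iffD2, rotated]) (rule real_prox_objective[OF assms(2)])

locale proper_convex_lsc =
  fixes S :: "'a::{real_inner, banach} set" and \<phi> :: "'a \<Rightarrow> ereal"
  assumes closed: "closed S" and proper: "proper_on S \<phi>"
    and convex: "convex_ereal_on S \<phi>" and lsc: "lsc_on S \<phi>"
begin

lemma prox_objective_bounded_below:
  obtains b where "\<And>z. z \<in> S \<Longrightarrow> ereal b \<le> prox_objective \<phi> u z"
proof -
  obtain y s where y: "y \<in> S" "\<phi> y = ereal s"
    using proper unfolding proper_on_def by (metis ereal_cases)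
  obtain K where K: "0 \<le> K" "\<And>z. z \<in> S \<Longrightarrow> ereal (s - 1 - K * norm (z - y)) \<le> \<phi> z"
    using convex_lsc_linear_minorant[OF convex lsc y, of "s - 1"] by auto
  define b where "b = s - 1 - K * norm (u - y) - K\<^sup>2 / 2"
  have "ereal b \<le> prox_objective \<phi> u z" if "z \<in> S" for z
  proof -
    have "K * norm (z - y) \<le> K * (norm (u - z) + norm (u - y))"
      using K(1) norm_triangle_ineq4[of "u - y" "u - z"]
      by (intro mult_left_mono) (auto simp: add.commute)
    moreover have "0 \<le> (K - norm (u - z))\<^sup>2" by simp
    ultimately have "b \<le> s - 1 - K * norm (z - y) + 1 / 2 * (norm (u - z))\<^sup>2"
      by (simp add: b_def power2_eq_square algebra_simps)
    then have "ereal b \<le> ereal (s - 1 - K * norm (z - y)) + ereal (1 / 2 * (norm (u - z))\<^sup>2)"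
      by simp
    also have "\<dots> \<le> prox_objective \<phi> u z"
      unfolding prox_objective_def by (intro add_right_mono K \<open>z \<in> S\<close>)
    finally show ?thesis .
  qed
  then show ?thesis by (rule that)
qed

lemma
  shows prox_mem: "prox S \<phi> u \<in> S"
    and prox_minimizes: "z \<in> S \<Longrightarrow> prox_objective \<phi> u (prox S \<phi> u) \<le> prox_objective \<phi> u z"
proof -
  obtain b where "\<And>z. z \<in> S \<Longrightarrow> ereal b \<le> prox_objective \<phi> u z"
    using prox_objective_bounded_below by blast
  then obtain y where "y \<in> S" "\<And>z. z \<in> S \<Longrightarrow> prox_objective \<phi> u y \<le> prox_objective \<phi> u z"
    by (rule strongly_convex_lsc_attains_minimum[OF closed proper_on_prox_objective[OF proper]
          lsc_on_prox_objective[OF lsc proper] strongly_convex_on_prox_objective[OF convex proper]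
          zero_less_one]) blast+
  then have "is_arg_min (prox_objective \<phi> u) (\<lambda>z. z \<in> S) y"
    by (auto simp: is_arg_min_def not_less)
  then have "is_arg_min (prox_objective \<phi> u) (\<lambda>z. z \<in> S) (prox S \<phi> u)"
    unfolding prox_def arg_min_on_def arg_min_def prox_objective_def[abs_def] by (rule someI)
  then show "prox S \<phi> u \<in> S"
    "z \<in> S \<Longrightarrow> prox_objective \<phi> u (prox S \<phi> u) \<le> prox_objective \<phi> u z"
    by (auto simp: is_arg_min_def not_less)
qed

lemma prox_mem_effective_domain: "prox S \<phi> u \<in> effective_domain S \<phi>"
proof -
  obtain z where "z \<in> S" "prox_objective \<phi> u z \<noteq> \<infinity>"
    using proper by (auto simp: proper_on_def prox_objective_def)
  then have "prox_objective \<phi> u (prox S \<phi> u) \<noteq> \<infinity>"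
    using prox_minimizes by (metis ereal_infty_less_eq(1))
  then show ?thesis
    using prox_mem by (simp add: effective_domain_def prox_objective_def)
qed

lemma real_prox_minimizes:
  assumes "z \<in> effective_domain S \<phi>"
  shows "real_of_ereal (prox_objective \<phi> u (prox S \<phi> u)) \<le> real_of_ereal (prox_objective \<phi> u z)"
proof -
  have finite_value: "ereal (real_of_ereal (prox_objective \<phi> u w)) = prox_objective \<phi> u w"
    if "w \<in> effective_domain S \<phi>" for w
    using ereal_real_effective_domain[OF proper_on_prox_objective[OF proper]] that
    by (simp add: effective_domain_prox_objective)
  have "prox_objective \<phi> u (prox S \<phi> u) \<le> prox_objective \<phi> u z"
    using assms by (intro prox_minimizes) (simp add: effective_domain_def)
  then show ?thesis
    using finite_value[OF prox_mem_effective_domain] finite_value[OF assms]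
    by (metis ereal_less_eq(3))
qed

lemma prox_variational_inequality:
  assumes z: "z \<in> effective_domain S \<phi>"
  shows "real_of_ereal (\<phi> (prox S \<phi> u)) + inner (u - prox S \<phi> u) (z - prox S \<phi> u)
    \<le> real_of_ereal (\<phi> z)"
proof -
  define y where "y = prox S \<phi> u"
  have y: "y \<in> effective_domain S \<phi>"
    unfolding y_def by (rule prox_mem_effective_domain)
  have "real_of_ereal (prox_objective \<phi> u y) + 1 / 2 * (norm (z - y))\<^sup>2
      \<le> real_of_ereal (prox_objective \<phi> u z)"
    using y z real_prox_minimizes[of _ u] strongly_convex_on_prox_objective[OF convex proper, of u]
    by (intro strongly_convex_on_growth_at_minimum[where S = "effective_domain S \<phi>"])
      (simp_all add: effective_domain_prox_objective y_def)
  then have "real_of_ereal (\<phi> y) + 1 / 2 * (norm (u - y))\<^sup>2 + 1 / 2 * (norm (z - y))\<^sup>2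
      \<le> real_of_ereal (\<phi> z) + 1 / 2 * (norm (u - z))\<^sup>2"
    by (simp only: real_prox_objective[OF proper y] real_prox_objective[OF proper z])
  moreover have "(norm (u - z))\<^sup>2 = (norm (u - y))\<^sup>2 - 2 * inner (u - y) (z - y) + (norm (z - y))\<^sup>2"
    by (simp add: power2_norm_eq_inner inner_diff_left inner_diff_right inner_commute)
  ultimately show ?thesis
    unfolding y_def by (simp add: field_simps)
qed

end

section \<open>Weighted norms\<close>

definition block_scale :: "('m::finite \<Rightarrow> real) \<Rightarrow> 'a::real_vector ^ 'm \<Rightarrow> 'a ^ 'm" where
  "block_scale w z = (\<chi> i. sqrt (w i) *\<^sub>R z $ i)"

lemma block_scale_diff: "block_scale w (y - z) = block_scale w y - block_scale w z"
  by (simp add: block_scale_def vec_eq_iff scaleR_right_diff_distrib)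

lemma block_scale_inverse:
  assumes "\<And>i. 0 < w i"
  shows "block_scale (\<lambda>i. inverse (w i)) (block_scale w z) = z"
proof -
  have "w i \<noteq> 0" for i
    using assms[of i] by simp
  then show ?thesis
    by (simp add: block_scale_def vec_eq_iff flip: real_sqrt_mult)
qed

lemma tendsto_block_scale [tendsto_intros]:
  fixes g :: "'b \<Rightarrow> 'a::real_normed_vector ^ 'm::finite"
  assumes "(g \<longlongrightarrow> l) F"
  shows "((\<lambda>z. block_scale w (g z)) \<longlongrightarrow> block_scale w l) F"
  unfolding block_scale_def by (intro tendsto_intros assms)

lemma wnorm_eq_norm_block_scale: "(\<And>i. 0 \<le> w i) \<Longrightarrow> wnorm w z = norm (block_scale w z)"
  by (simp add: wnorm_def norm_vec_def L2_set_def block_scale_def power_mult_distrib)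

lemma wnorm_nonneg: "(\<And>i. 0 \<le> w i) \<Longrightarrow> 0 \<le> wnorm w z"
  by (simp add: wnorm_eq_norm_block_scale)

lemma wnorm_power2: "(\<And>i. 0 \<le> w i) \<Longrightarrow> (wnorm w z)\<^sup>2 = (\<Sum>i\<in>UNIV. w i * (norm (z $ i))\<^sup>2)"
  by (simp add: wnorm_def sum_nonneg)

lemma wnorm_minus_commute: "wnorm w (y - z) = wnorm w (z - y)"
  by (simp add: wnorm_def norm_minus_commute)

lemma wnorm_Cauchy_Schwarz:
  fixes y z :: "'a::real_inner ^ 'm::finite"
  assumes "\<And>i. 0 \<le> w i"
  shows "(\<Sum>i\<in>UNIV. w i * inner (y $ i) (z $ i)) \<le> wnorm w y * wnorm w z"
proof -
  have "(\<Sum>i\<in>UNIV. w i * inner (y $ i) (z $ i)) = inner (block_scale w y) (block_scale w z)"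
    using assms by (simp add: inner_vec_def block_scale_def mult.assoc[symmetric])
  also have "\<dots> \<le> wnorm w y * wnorm w z"
    using assms by (simp add: wnorm_eq_norm_block_scale norm_cauchy_schwarz)
  finally show ?thesis .
qed

section \<open>Random sequences with summable increments\<close>

lemma convergent_of_summable_increments:
  fixes u :: "nat \<Rightarrow> 'a::banach"
  assumes "summable (\<lambda>n. norm (u (Suc n) - u n))"
  shows "convergent u"
proof -
  have "convergent (\<lambda>n. \<Sum>k<n. u (Suc k) - u k)"
    using summable_norm_cancel[OF assms] by (simp add: summable_iff_convergent)
  then have "convergent (\<lambda>n. u n - u 0)"
    by (simp add: sum_lessThan_telescope)
  then show ?thesis
    by (simp add: convergent_diff_const_right_iff)
qed

lemma norm_diff_limit_le_suminf_increments:
  fixes u :: "nat \<Rightarrow> 'a::banach"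
  assumes summable: "summable (\<lambda>n. norm (u (Suc n) - u n))" and lim: "u \<longlonglongrightarrow> l"
  shows "norm (u n - l) \<le> (\<Sum>k. norm (u (Suc (k + n)) - u (k + n)))"
proof -
  have "(\<lambda>k. u (Suc k + n) - u (k + n)) sums (l - u (0 + n))"
    using LIMSEQ_ignore_initial_segment[OF lim] by (rule telescope_sums)
  then have "l - u n = (\<Sum>k. u (Suc (k + n)) - u (k + n))"
    by (simp add: sums_iff)
  moreover have "summable (\<lambda>k. norm (u (Suc (k + n)) - u (k + n)))"
    using summable_ignore_initial_segment[OF summable, of n] by simp
  ultimately show ?thesis
    using summable_norm by (metis norm_minus_commute)
qed

lemma AE_summable_norm:
  fixes g :: "nat \<Rightarrow> 'a \<Rightarrow> 'b::{banach, second_countable_topology}"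
  assumes int: "\<And>n. integrable M (g n)" and summable: "summable (\<lambda>n. \<integral>\<omega>. norm (g n \<omega>) \<partial>M)"
  shows "AE \<omega> in M. summable (\<lambda>n. norm (g n \<omega>))"
proof -
  have [measurable]: "g n \<in> borel_measurable M" for n
    using int by auto
  have "(\<integral>\<^sup>+\<omega>. (\<Sum>n. ennreal (norm (g n \<omega>))) \<partial>M) = (\<Sum>n. \<integral>\<^sup>+\<omega>. ennreal (norm (g n \<omega>)) \<partial>M)"
    by (intro nn_integral_suminf) auto
  also have "\<dots> = (\<Sum>n. ennreal (\<integral>\<omega>. norm (g n \<omega>) \<partial>M))"
    using int by (subst nn_integral_eq_integral) auto
  also have "\<dots> = ennreal (\<Sum>n. \<integral>\<omega>. norm (g n \<omega>) \<partial>M)"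
    using summable by (intro suminf_ennreal2) auto
  finally have "AE \<omega> in M. (\<Sum>n. ennreal (norm (g n \<omega>))) \<noteq> \<infinity>"
    by (intro nn_integral_PInf_AE) auto
  then show ?thesis
    by eventually_elim (auto intro: summable_suminf_not_top)
qed

lemma AE_convergent_of_summable_increments:
  fixes u :: "nat \<Rightarrow> 'a \<Rightarrow> 'b::banach"
  assumes "\<And>n. integrable M (\<lambda>\<omega>. norm (u (Suc n) \<omega> - u n \<omega>))"
    and "summable (\<lambda>n. \<integral>\<omega>. norm (u (Suc n) \<omega> - u n \<omega>) \<partial>M)"
  shows "AE \<omega> in M. convergent (\<lambda>n. u n \<omega>)"
proof -
  have "AE \<omega> in M. summable (\<lambda>n. norm (norm (u (Suc n) \<omega> - u n \<omega>)))"
    using assms by (intro AE_summable_norm) simp_all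
  then show ?thesis
    by eventually_elim (simp add: convergent_of_summable_increments)
qed

text \<open>The distances to the limit are assumed measurable because \<open>'b\<close> need not be second countable.\<close>

lemma
  fixes u :: "nat \<Rightarrow> 'a \<Rightarrow> 'b::banach"
  assumes int: "\<And>n. integrable M (\<lambda>\<omega>. norm (u (Suc n) \<omega> - u n \<omega>))"
    and summable: "summable (\<lambda>n. \<integral>\<omega>. norm (u (Suc n) \<omega> - u n \<omega>) \<partial>M)"
    and lim: "AE \<omega> in M. (\<lambda>n. u n \<omega>) \<longlonglongrightarrow> l \<omega>"
    and meas: "(\<lambda>\<omega>. norm (u n \<omega> - l \<omega>)) \<in> borel_measurable M"
  shows integrable_norm_diff_limit: "integrable M (\<lambda>\<omega>. norm (u n \<omega> - l \<omega>))"
    and integral_norm_diff_limit_le: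
      "(\<integral>\<omega>. norm (u n \<omega> - l \<omega>) \<partial>M) \<le> (\<Sum>k. \<integral>\<omega>. norm (u (Suc (k + n)) \<omega> - u (k + n) \<omega>) \<partial>M)"
proof -
  let ?d = "\<lambda>k \<omega>. norm (u (Suc (k + n)) \<omega> - u (k + n) \<omega>)"
  have AE_summable: "AE \<omega> in M. summable (\<lambda>n. norm (norm (u (Suc n) \<omega> - u n \<omega>)))"
    using int summable by (intro AE_summable_norm) simp_all
  have tail: "integrable M (?d k)" "AE \<omega> in M. summable (\<lambda>k. norm (?d k \<omega>))"
    "summable (\<lambda>k. \<integral>\<omega>. norm (?d k \<omega>) \<partial>M)" for k
  proof -
    show "integrable M (?d k)"
      by (rule int)
    show "AE \<omega> in M. summable (\<lambda>k. norm (?d k \<omega>))"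
      using AE_summable by eventually_elim (rule summable_ignore_initial_segment)
    show "summable (\<lambda>k. \<integral>\<omega>. norm (?d k \<omega>) \<partial>M)"
      unfolding real_norm_def abs_norm_cancel using summable
      by (rule summable_ignore_initial_segment)
  qed
  note integrable_tail = integrable_suminf[OF tail] and integral_tail = integral_suminf[OF tail]
  have dist_le_tail: "AE \<omega> in M. norm (u n \<omega> - l \<omega>) \<le> (\<Sum>k. ?d k \<omega>)"
    using AE_summable lim by eventually_elim (rule norm_diff_limit_le_suminf_increments, simp_all)
  show integrable: "integrable M (\<lambda>\<omega>. norm (u n \<omega> - l \<omega>))"
  proof (rule Bochner_Integration.integrable_bound[OF integrable_tail meas])
    show "AE \<omega> in M. norm (norm (u n \<omega> - l \<omega>)) \<le> norm (\<Sum>k. ?d k \<omega>)"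
      using dist_le_tail by eventually_elim (simp add: order_trans[OF _ abs_ge_self])
  qed
  show "(\<integral>\<omega>. norm (u n \<omega> - l \<omega>) \<partial>M) \<le> (\<Sum>k. \<integral>\<omega>. ?d k \<omega> \<partial>M)"
    unfolding integral_tail[symmetric]
    by (rule integral_mono_AE[OF integrable integrable_tail dist_le_tail])
qed

lemma
  fixes d :: "nat \<Rightarrow> real"
  assumes bound: "\<And>n. 0 \<le> d n" "\<And>n. d n \<le> C * q ^ n" and q: "0 \<le> q" "q < 1"
  shows summable_of_geometric_bound: "summable d"
    and suminf_tail_le_geometric: "(\<Sum>k. d (k + n)) \<le> C / (1 - q) * q ^ n"
proof -
  have geometric: "(\<lambda>k. C * q ^ (k + n)) sums (C / (1 - q) * q ^ n)" for n
    using sums_mult[OF geometric_sums[of q], of "C * q ^ n"] q by (simp add: power_add mult_ac)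
  show summable: "summable d"
    using bound sums_summable[OF geometric[of 0]]
    by (intro summable_comparison_test[of d "\<lambda>n. C * q ^ n"]) auto
  have "(\<Sum>k. d (k + n)) \<le> (\<Sum>k. C * q ^ (k + n))"
    by (intro suminf_le bound(2) summable_ignore_initial_segment[OF summable]
        sums_summable[OF geometric])
  also have "\<dots> = C / (1 - q) * q ^ n"
    using geometric by (rule sums_unique[symmetric])
  finally show "(\<Sum>k. d (k + n)) \<le> C / (1 - q) * q ^ n" .
qed

lemma borel_measurable_AE_limit_in:
  fixes u :: "nat \<Rightarrow> 'a \<Rightarrow> 'b::metric_space"
  assumes meas: "\<And>n. u n \<in> borel_measurable M"
    and AE: "AE \<omega> in M. \<exists>z\<in>S. (\<lambda>n. u n \<omega>) \<longlonglongrightarrow> z"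
    and "s \<in> S"
  obtains l where "l \<in> borel_measurable M" "\<And>\<omega>. \<omega> \<in> space M \<Longrightarrow> l \<omega> \<in> S"
    "AE \<omega> in M. (\<lambda>n. u n \<omega>) \<longlonglongrightarrow> l \<omega>"
proof -
  obtain N where N: "{\<omega> \<in> space M. \<not> (\<exists>z\<in>S. (\<lambda>n. u n \<omega>) \<longlonglongrightarrow> z)} \<subseteq> N" "N \<in> null_sets M"
    using AE by (auto simp: eventually_ae_filter)
  define l where "l \<omega> = (if \<omega> \<in> N then s else lim (\<lambda>n. u n \<omega>))" for \<omega>
  have l_limit: "l \<omega> \<in> S \<and> (\<lambda>n. u n \<omega>) \<longlonglongrightarrow> l \<omega>" if "\<omega> \<in> space M" "\<omega> \<notin> N" for \<omega>
    using N(1) that by (auto simp: l_def limI)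
  show ?thesis
  proof (rule that[of l])
    show "l \<in> borel_measurable M"
    proof (rule borel_measurable_LIMSEQ_metric)
      show "(\<lambda>\<omega>. if \<omega> \<in> N then s else u n \<omega>) \<in> borel_measurable M" for n
        using N(2) meas by (intro measurable_If_set) auto
      show "(\<lambda>n. if \<omega> \<in> N then s else u n \<omega>) \<longlonglongrightarrow> l \<omega>" if "\<omega> \<in> space M" for \<omega>
        using l_limit[OF that] by (simp add: l_def)
    qed
    show "l \<omega> \<in> S" if "\<omega> \<in> space M" for \<omega>
      using l_limit[OF that] \<open>s \<in> S\<close> by (cases "\<omega> \<in> N") (simp_all add: l_def)
    show "AE \<omega> in M. (\<lambda>n. u n \<omega>) \<longlonglongrightarrow> l \<omega>"
      using AE_not_in[OF N(2)] AE_space by eventually_elim (use l_limit in blast)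
  qed
qed

lemma borel_measurable_wnorm_diff:
  fixes y z :: "'w \<Rightarrow> 'a::{real_normed_vector, second_countable_topology} ^ 'm::finite"
  assumes "y \<in> borel_measurable M" "z \<in> borel_measurable M"
  shows "(\<lambda>\<omega>. wnorm w (y \<omega> - z \<omega>)) \<in> borel_measurable M"
proof -
  have "(\<lambda>v :: 'a ^ 'm. v $ i) \<in> borel_measurable borel" for i
    by (intro borel_measurable_continuous_onI continuous_intros)
  note [measurable] = measurable_compose[OF assms(1) this] measurable_compose[OF assms(2) this]
  show ?thesis
    unfolding wnorm_def vector_minus_component by measurable
qed

lemma bigo_powr_half:
  fixes g :: "nat \<Rightarrow> real"
  assumes "0 \<le> r" and bound: "\<And>n. \<bar>g n\<bar> \<le> C * sqrt r ^ n"
  shows "g \<in> O(\<lambda>n. r powr (real n / 2))"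
proof (rule bigoI)
  \<comment> \<open>The identity fails for \<open>n = 0\<close> and \<open>r = 0\<close>, because \<open>0 powr 0 = 0\<close>.\<close>
  have "r powr (real n / 2) = sqrt r ^ n" if "1 \<le> n" for n
    using \<open>0 \<le> r\<close> that
    by (cases "r = 0")
      (simp_all add: powr_half_sqrt_powr powr_realpow real_sqrt_power flip: powr_powr)
  then show "\<forall>\<^sub>F n in sequentially. norm (g n) \<le> C * norm (r powr (real n / 2))"
    using bound \<open>0 \<le> r\<close> by (intro eventually_sequentiallyI[of 1]) simp
qed

lemma ereal_expectation_ereal:
  assumes "integrable M y" "\<And>\<omega>. \<omega> \<in> space M \<Longrightarrow> Y \<omega> = ereal (y \<omega>)"
  shows "ereal_expectation M Y = ereal (\<integral>\<omega>. y \<omega> \<partial>M)"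
proof -
  have parts: "(\<integral>\<^sup>+\<omega>. e2ennreal (Y \<omega>) \<partial>M) = (\<integral>\<^sup>+\<omega>. ennreal (y \<omega>) \<partial>M)"
    "(\<integral>\<^sup>+\<omega>. e2ennreal (- Y \<omega>) \<partial>M) = (\<integral>\<^sup>+\<omega>. ennreal (- y \<omega>) \<partial>M)"
    using assms(2) by (auto intro!: nn_integral_cong)
  have parts_finite: "(\<integral>\<^sup>+\<omega>. ennreal (y \<omega>) \<partial>M) \<noteq> \<infinity>" "(\<integral>\<^sup>+\<omega>. ennreal (- y \<omega>) \<partial>M) \<noteq> \<infinity>"
    using assms(1) by (auto simp: real_integrable_def)
  show ?thesis
    unfolding ereal_expectation_def parts real_lebesgue_integral_def[OF assms(1)]
    using parts_finite by (cases "\<integral>\<^sup>+\<omega>. ennreal (y \<omega>) \<partial>M" rule: ennreal_cases;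
        cases "\<integral>\<^sup>+\<omega>. ennreal (- y \<omega>) \<partial>M" rule: ennreal_cases) auto
qed

section \<open>Random iterations with finitely valued innovations\<close>

context prob_space
begin

lemma expectation_le_sqrt_expectation_power2:
  fixes g :: "'a \<Rightarrow> real"
  assumes "integrable M g" "integrable M (\<lambda>\<omega>. (g \<omega>)\<^sup>2)"
  shows "expectation g \<le> sqrt (expectation (\<lambda>\<omega>. (g \<omega>)\<^sup>2))"
  using variance_eq[OF assms] variance_positive[of g] by (intro real_le_rsqrt) simp

lemma integrable_finite_range:
  fixes g :: "'b \<Rightarrow> 'c::{banach, second_countable_topology}"
  assumes "Y \<in> measurable M (count_space UNIV)" "finite (Y ` space M)"
  shows "integrable M (\<lambda>\<omega>. g (Y \<omega>))"
proof (rule integrable_const_bound)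
  show "AE \<omega> in M. norm (g (Y \<omega>)) \<le> Max ((\<lambda>y. norm (g y)) ` Y ` space M)"
    using assms(2) by (intro AE_I2 Max_ge) auto
  show "(\<lambda>\<omega>. g (Y \<omega>)) \<in> borel_measurable M"
    by (rule measurable_compose[OF assms(1)]) simp
qed

lemma expectation_indep_var_iterated:
  fixes \<phi> :: "'b \<Rightarrow> 'b \<Rightarrow> 'c::{banach, second_countable_topology}"
  assumes indep: "indep_var S Y T Z"
    and meas: "case_prod \<phi> \<in> borel_measurable (S \<Otimes>\<^sub>M T)" and int: "integrable M (\<lambda>\<omega>. \<phi> (Y \<omega>) (Z \<omega>))"
  shows "expectation (\<lambda>\<omega>. \<phi> (Y \<omega>) (Z \<omega>)) = expectation (\<lambda>\<omega>. expectation (\<lambda>\<omega>'. \<phi> (Y \<omega>) (Z \<omega>')))"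
proof -
  note [measurable] = indep_var_rv1[OF indep] indep_var_rv2[OF indep] meas
  interpret Y: prob_space "distr M S Y" by (rule prob_space_distr) simp
  interpret Z: prob_space "distr M T Z" by (rule prob_space_distr) simp
  interpret YZ: pair_prob_space "distr M S Y" "distr M T Z" ..
  have joint: "distr M S Y \<Otimes>\<^sub>M distr M T Z = distr M (S \<Otimes>\<^sub>M T) (\<lambda>\<omega>. (Y \<omega>, Z \<omega>))"
    using indep by (simp add: indep_var_distribution_eq)
  have "expectation (\<lambda>\<omega>. \<phi> (Y \<omega>) (Z \<omega>)) = (\<integral>b. case_prod \<phi> b \<partial>(distr M S Y \<Otimes>\<^sub>M distr M T Z))"
    by (simp add: joint integral_distr)
  also have "\<dots> = (\<integral>y. (\<integral>z. \<phi> y z \<partial>distr M T Z) \<partial>distr M S Y)"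
    using int by (intro YZ.integral_fst[symmetric]) (simp add: joint integrable_distr_eq)
  also have "\<dots> = expectation (\<lambda>\<omega>. \<integral>z. \<phi> (Y \<omega>) z \<partial>distr M T Z)"
    by (rule integral_distr) measurable
  also have "\<dots> = expectation (\<lambda>\<omega>. expectation (\<lambda>\<omega>'. \<phi> (Y \<omega>) (Z \<omega>')))"
  proof (intro Bochner_Integration.integral_cong refl)
    fix \<omega> assume "\<omega> \<in> space M"
    then have "Y \<omega> \<in> space S"
      by (rule measurable_space[OF indep_var_rv1[OF indep]])
    then have "\<phi> (Y \<omega>) \<in> borel_measurable T"
      using measurable_Pair2[OF meas] by simp
    then show "(\<integral>z. \<phi> (Y \<omega>) z \<partial>distr M T Z) = expectation (\<lambda>\<omega>'. \<phi> (Y \<omega>) (Z \<omega>'))"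
      by (simp add: integral_distr)
  qed
  finally show ?thesis .
qed

end

primrec random_iterate :: "('s \<Rightarrow> 'e \<Rightarrow> 's) \<Rightarrow> 's \<Rightarrow> nat \<Rightarrow> (nat \<Rightarrow> 'e) \<Rightarrow> 's" where
  "random_iterate \<Phi> s 0 e = s"
| "random_iterate \<Phi> s (Suc n) e = \<Phi> (random_iterate \<Phi> s n e) (e n)"

lemma random_iterate_restrict:
  "n \<le> N \<Longrightarrow> random_iterate \<Phi> s n (restrict e {..<N}) = random_iterate \<Phi> s n e"
  by (induction n) auto

lemma finite_range_random_iterate:
  fixes \<Phi> :: "'s \<Rightarrow> 'e::finite \<Rightarrow> 's"
  shows "finite (range (random_iterate \<Phi> s n))"
proof (induction n)
  case (Suc n)
  have "range (random_iterate \<Phi> s (Suc n)) \<subseteq> case_prod \<Phi> ` (range (random_iterate \<Phi> s n) \<times> UNIV)"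
    by auto
  then show ?case
    by (rule finite_subset) (use Suc in simp)
qed simp

lemma measurable_apply_count_space:
  fixes Z :: "'w \<Rightarrow> 'e::countable"
  assumes Y: "Y \<in> measurable M (count_space UNIV)" and Z: "Z \<in> measurable M (count_space UNIV)"
    and \<phi>: "\<And>y e. \<phi> y e \<in> space N"
  shows "(\<lambda>\<omega>. \<phi> (Y \<omega>) (Z \<omega>)) \<in> measurable M N"
proof (rule measurable_compose_countable'[where f = "\<lambda>e \<omega>. \<phi> (Y \<omega>) e", OF _ Z])
  show "(\<lambda>\<omega>. \<phi> (Y \<omega>) e) \<in> measurable M N" for e
    by (rule measurable_compose[OF Y, of "\<lambda>y. \<phi> y e"]) (simp add: \<phi>)
qed simp

lemma measurable_random_iterate:
  fixes \<Phi> :: "'s \<Rightarrow> 'e::countable \<Rightarrow> 's"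
  assumes "n \<le> N"
  shows "random_iterate \<Phi> s n \<in> measurable (PiM {..<N} (\<lambda>_. count_space UNIV)) (count_space UNIV)"
  using assms
proof (induction n)
  case 0
  have "random_iterate \<Phi> s 0 = (\<lambda>_. s)" by auto
  then show ?case by simp
next
  case (Suc n)
  let ?P = "PiM {..<N} (\<lambda>_. count_space (UNIV :: 'e set))"
  have "(\<lambda>e. e n) \<in> measurable ?P (count_space UNIV)"
    using Suc.prems by (intro measurable_component_singleton) simp
  with Suc have "(\<lambda>e. \<Phi> (random_iterate \<Phi> s n e) (e n)) \<in> measurable ?P (count_space UNIV)"
    by (intro measurable_apply_count_space[where \<phi> = \<Phi>]) simp_all
  then show ?case by simp
qed

locale random_iteration = prob_space M
  for M :: "'w measure" +
  fixes \<Phi> :: "'s \<Rightarrow> 'e::finite \<Rightarrow> 's" and s :: 's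
    and \<epsilon> :: "'w \<Rightarrow> 'e" and eps :: "nat \<Rightarrow> 'w \<Rightarrow> 'e" and x :: "nat \<Rightarrow> 'w \<Rightarrow> 's"
  assumes measurable_\<epsilon>: "\<epsilon> \<in> measurable M (count_space UNIV)"
    and indep_eps: "indep_vars (\<lambda>_. count_space UNIV) eps UNIV"
    and distr_eps: "\<And>n. distr M (count_space UNIV) (eps n) = distr M (count_space UNIV) \<epsilon>"
    and iterate_0: "\<And>\<omega>. \<omega> \<in> space M \<Longrightarrow> x 0 \<omega> = s"
    and iterate_Suc: "\<And>n \<omega>. \<omega> \<in> space M \<Longrightarrow> x (Suc n) \<omega> = \<Phi> (x n \<omega>) (eps n \<omega>)"
begin

abbreviation past :: "nat \<Rightarrow> 'w \<Rightarrow> nat \<Rightarrow> 'e" where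
  "past n \<omega> \<equiv> restrict (\<lambda>k. eps k \<omega>) {..<n}"

lemma measurable_eps: "eps n \<in> measurable M (count_space UNIV)"
  using indep_eps unfolding indep_vars_def by blast

lemma expectation_eps:
  fixes g :: "'e \<Rightarrow> 'b::{banach, second_countable_topology}"
  shows "expectation (\<lambda>\<omega>. g (eps n \<omega>)) = expectation (\<lambda>\<omega>. g (\<epsilon> \<omega>))"
  using integral_distr[OF measurable_eps[of n], of g] integral_distr[OF measurable_\<epsilon>, of g]
  by (simp add: distr_eps)

lemma indep_past_present:
  "indep_var (PiM {..<n} (\<lambda>_. count_space UNIV)) (past n)
    (PiM {n} (\<lambda>_. count_space UNIV)) (\<lambda>\<omega>. restrict (\<lambda>k. eps k \<omega>) {n})"
  using indep_eps by (rule indep_var_restrict) auto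

lemma iterate_eq_random_iterate:
  assumes "\<omega> \<in> space M"
  shows "x n \<omega> = random_iterate \<Phi> s n (past n \<omega>)"
proof -
  have "x n \<omega> = random_iterate \<Phi> s n (\<lambda>k. eps k \<omega>)"
    by (induction n) (simp_all add: iterate_0 iterate_Suc assms)
  then show ?thesis by (simp add: random_iterate_restrict)
qed

lemma measurable_iterate: "x n \<in> measurable M (count_space UNIV)"
proof -
  have "(\<lambda>\<omega>. random_iterate \<Phi> s n (past n \<omega>)) \<in> measurable M (count_space UNIV)"
    by (rule measurable_compose[OF indep_var_rv1[OF indep_past_present]
          measurable_random_iterate]) simp
  then show ?thesis
    by (subst measurable_cong[OF iterate_eq_random_iterate])
qed

lemma finite_range_iterate: "finite (x n ` space M)"
  by (rule finite_subset[OF _ finite_range_random_iterate[of \<Phi> s n]])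
    (auto simp: iterate_eq_random_iterate)

lemma integrable_iterate:
  fixes g :: "'s \<Rightarrow> 'b::{banach, second_countable_topology}"
  shows "integrable M (\<lambda>\<omega>. g (x n \<omega>))"
  by (rule integrable_finite_range[OF measurable_iterate finite_range_iterate])

lemma integrable_iterate_eps:
  fixes \<phi> :: "'s \<Rightarrow> 'e \<Rightarrow> 'b::{banach, second_countable_topology}"
  shows "integrable M (\<lambda>\<omega>. \<phi> (x n \<omega>) (eps n \<omega>))"
proof -
  have "finite ((\<lambda>\<omega>. (x n \<omega>, eps n \<omega>)) ` space M)"
    by (rule finite_subset[OF _ finite_cartesian_product[OF finite_range_iterate[of n] finite]])
      auto
  moreover have "(\<lambda>\<omega>. (x n \<omega>, eps n \<omega>)) \<in> measurable M (count_space UNIV)"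
    using measurable_iterate measurable_eps
    by (rule measurable_apply_count_space[where \<phi> = Pair]) simp
  ultimately show ?thesis
    using integrable_finite_range[of "\<lambda>\<omega>. (x n \<omega>, eps n \<omega>)" "case_prod \<phi>"] by simp
qed

lemma expectation_iterate_eps:
  fixes \<phi> :: "'s \<Rightarrow> 'e \<Rightarrow> 'b::{banach, second_countable_topology}"
  shows "expectation (\<lambda>\<omega>. \<phi> (x n \<omega>) (eps n \<omega>))
    = expectation (\<lambda>\<omega>. expectation (\<lambda>\<omega>'. \<phi> (x n \<omega>) (\<epsilon> \<omega>')))"
proof -
  let ?P = "PiM {..<n} (\<lambda>_. count_space UNIV) :: (nat \<Rightarrow> 'e) measure"
  let ?N = "PiM {n} (\<lambda>_. count_space UNIV) :: (nat \<Rightarrow> 'e) measure"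
  let ?\<psi> = "\<lambda>e e'. \<phi> (random_iterate \<Phi> s n e) (e' n)"
  have "(\<lambda>(e, e'). ?\<psi> e e') \<in> borel_measurable (?P \<Otimes>\<^sub>M ?N)"
    unfolding case_prod_beta
  proof (rule measurable_apply_count_space[where \<phi> = \<phi>])
    show "(\<lambda>b. random_iterate \<Phi> s n (fst b)) \<in> measurable (?P \<Otimes>\<^sub>M ?N) (count_space UNIV)"
      by (rule measurable_compose[OF measurable_fst measurable_random_iterate]) simp
    show "(\<lambda>b. snd b n) \<in> measurable (?P \<Otimes>\<^sub>M ?N) (count_space UNIV)"
      by (rule measurable_compose[OF measurable_snd measurable_component_singleton]) simp
  qed simp
  moreover have "integrable M (\<lambda>\<omega>. ?\<psi> (past n \<omega>) (restrict (\<lambda>k. eps k \<omega>) {n}))"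
    using integrable_iterate_eps[of \<phi> n]
    by (simp add: iterate_eq_random_iterate cong: Bochner_Integration.integrable_cong)
  ultimately have "expectation (\<lambda>\<omega>. ?\<psi> (past n \<omega>) (restrict (\<lambda>k. eps k \<omega>) {n}))
      = expectation (\<lambda>\<omega>. expectation (\<lambda>\<omega>'. ?\<psi> (past n \<omega>) (restrict (\<lambda>k. eps k \<omega>') {n})))"
    by (rule expectation_indep_var_iterated[OF indep_past_present])
  then have "expectation (\<lambda>\<omega>. \<phi> (x n \<omega>) (eps n \<omega>))
    = expectation (\<lambda>\<omega>. expectation (\<lambda>\<omega>'. \<phi> (x n \<omega>) (eps n \<omega>')))"
    by (simp add: iterate_eq_random_iterate cong: Bochner_Integration.integral_cong)
  also have "\<dots> = expectation (\<lambda>\<omega>. expectation (\<lambda>\<omega>'. \<phi> (x n \<omega>) (\<epsilon> \<omega>')))"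
    by (intro Bochner_Integration.integral_cong refl expectation_eps)
  finally show ?thesis .
qed

end

section \<open>The forward-backward step\<close>

lemma subspace_direct_sum: "(\<And>i. subspace (V i)) \<Longrightarrow> subspace (direct_sum V)"
  by (simp add: subspace_def direct_sum_def)

lemma closed_direct_sum:
  fixes V :: "'m::finite \<Rightarrow> 'a::topological_space set"
  assumes "\<And>i. closed (V i)"
  shows "closed (direct_sum V)"
proof -
  have "direct_sum V = (\<Inter>i. (\<lambda>y. y $ i) -` V i)"
    by (auto simp: direct_sum_def)
  moreover have "closed ((\<lambda>y :: 'a ^ 'm. y $ i) -` V i)" for i
    by (intro closed_vimage assms continuous_intros)
  ultimately show ?thesis
    by (simp add: closed_INT)
qed

lemma lsc_on_separable_sum:
  fixes V :: "'m::finite \<Rightarrow> 'a::real_normed_vector set"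
  assumes "\<And>i. lsc_on (V i) (h i)" "\<And>i. proper_on (V i) (h i)"
  shows "lsc_on (direct_sum V) (separable_sum h)"
  unfolding separable_sum_def[abs_def]
proof (rule lsc_on_sum)
  fix i show "lsc_on (direct_sum V) (\<lambda>y. h i (y $ i))"
  proof (rule lsc_on_compose[OF assms(1)[of i]])
    show "continuous_on (direct_sum V) (\<lambda>y. y $ i)"
      by (intro continuous_intros)
  qed (auto simp: direct_sum_def)
  show "h i (y $ i) \<noteq> -\<infinity>" if "y \<in> direct_sum V" for y
    using assms(2)[of i] that by (auto simp: proper_on_def direct_sum_def)
qed simp

lemma le_add_mult_cINF:
  fixes d :: "'a \<Rightarrow> real"
  assumes "S \<noteq> {}" "0 \<le> r" and bound: "\<And>z. z \<in> S \<Longrightarrow> s \<le> b + r * d z"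
  shows "s \<le> b + r * (INF z\<in>S. d z)"
proof (cases "r = 0")
  case False
  then have r: "0 < r"
    using assms(2) by simp
  have "(s - b) / r \<le> (INF z\<in>S. d z)"
    using bound r
    by (intro cINF_greatest assms(1)) (simp add: divide_simps mult.commute add.commute diff_le_eq)
  then show ?thesis
    using r by (simp add: divide_simps mult.commute)
qed (use assms in auto)

text \<open>A convex combination of the two hypotheses eliminates \<open>r\<close>.\<close>

lemma le_neg_min_mult:
  fixes s a c r g :: real
  assumes "0 \<le> a" "0 < c" "0 \<le> r"
    and bounds: "s \<le> - (a * r)" "s \<le> - g + (c - a) * r"
  shows "s \<le> - (min 1 (a / c) * g)"
proof (cases "c \<le> a")
  case True
  then have "(c - a) * r \<le> 0"
    using \<open>0 \<le> r\<close> by (simp add: mult_nonpos_nonneg)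
  then show ?thesis
    using bounds(2) True \<open>0 < c\<close> by simp
next
  case False
  define k where "k = a / c"
  have k: "0 \<le> k" "k \<le> 1" "k * c = a"
    using False \<open>0 \<le> a\<close> \<open>0 < c\<close> by (simp_all add: k_def)
  have "s = k * s + (1 - k) * s"
    by (simp add: algebra_simps)
  also have "\<dots> \<le> k * (- g + (c - a) * r) + (1 - k) * - (a * r)"
    using k by (intro add_mono mult_left_mono bounds) auto
  also have "\<dots> = - (k * g) + (k * c - a) * r"
    by (simp add: algebra_simps)
  finally show ?thesis
    using k by (simp add: k_def)
qed

locale block_composite =
  fixes V :: "'m::finite \<Rightarrow> 'a::{real_inner, banach} set"
    and f :: "'a ^ 'm \<Rightarrow> real"
    and grad :: "'a ^ 'm \<Rightarrow> 'a ^ 'm"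
    and h :: "'m \<Rightarrow> 'a \<Rightarrow> ereal"
    and \<gamma> \<nu> :: "'m \<Rightarrow> real"
    and \<delta> :: real
  assumes subspace_V: "\<And>i. subspace (V i)" and closed_V: "\<And>i. closed (V i)"
    and f_convex: "convex_on (direct_sum V) f"
    and f_derivative: "\<And>y. y \<in> direct_sum V \<Longrightarrow>
      (f has_derivative (\<lambda>v. inner (grad y) v)) (at y within direct_sum V)"
    and h_proper: "\<And>i. proper_on (V i) (h i)"
    and h_convex: "\<And>i. convex_ereal_on (V i) (h i)"
    and h_lsc: "\<And>i. lsc_on (V i) (h i)"
    and \<gamma>_pos: "\<And>i. 0 < \<gamma> i"
    and \<gamma>_\<nu>_le: "\<And>i. \<gamma> i * \<nu> i \<le> \<delta>" and \<delta>_less_2: "\<delta> < 2"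
begin

abbreviation H :: "('a ^ 'm) set" where
  "H \<equiv> direct_sum V"

abbreviation objective :: "'a ^ 'm \<Rightarrow> ereal" where
  "objective \<equiv> \<lambda>y. ereal (f y) + separable_sum h y"

abbreviation minimizers :: "('a ^ 'm) set" where
  "minimizers \<equiv> argmin_set objective H"

abbreviation fb :: "'a ^ 'm \<Rightarrow> 'a ^ 'm" where
  "fb \<equiv> fb_step V h grad \<gamma>"

abbreviation step :: "'a ^ 'm \<Rightarrow> 'a ^ 'm" where
  "step y \<equiv> fb y - y"

abbreviation \<Gamma>_norm :: "'a ^ 'm \<Rightarrow> real" where
  "\<Gamma>_norm \<equiv> wnorm (\<lambda>i. 1 / \<gamma> i)"

abbreviation real_h :: "'m \<Rightarrow> 'a \<Rightarrow> real" where
  "real_h i z \<equiv> real_of_ereal (h i z)"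

definition domain :: "('a ^ 'm) set" where
  "domain = direct_sum (\<lambda>i. effective_domain (V i) (h i))"

definition real_objective :: "'a ^ 'm \<Rightarrow> real" where
  "real_objective y = f y + (\<Sum>i\<in>UNIV. real_h i (y $ i))"

definition min_value :: real where
  "min_value = real_of_ereal (INF y\<in>H. objective y)"

definition gap :: "'a ^ 'm \<Rightarrow> real" where
  "gap y = real_objective y - min_value"

text \<open>The \<open>p\<^sub>i\<close>-weighted sum of the \<open>block_change y i\<close> bounds the expected change of the objective.\<close>

definition block_change :: "'a ^ 'm \<Rightarrow> 'm \<Rightarrow> real" where
  "block_change y i = real_h i (fb y $ i) - real_h i (y $ i)
     + inner (grad y $ i) (step y $ i) + \<nu> i / 2 * (norm (step y $ i))\<^sup>2"

lemma \<Gamma>_weight_nonneg: "0 \<le> 1 / \<gamma> i"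
  using \<gamma>_pos[of i] by simp

lemma subspace_H: "subspace H"
  using subspace_V by (rule subspace_direct_sum)

lemma closed_H: "closed H"
  using closed_V by (rule closed_direct_sum)

lemma domain_subset: "domain \<subseteq> H"
  by (auto simp: domain_def direct_sum_def effective_domain_def)

lemma domain_iff: "y \<in> domain \<longleftrightarrow> y \<in> H \<and> separable_sum h y < \<infinity>"
  by (auto simp: domain_def direct_sum_def effective_domain_def separable_sum_def sum_Pinfty
      less_top[symmetric] top_ereal_def)

lemma objective_real:
  assumes "y \<in> domain"
  shows "objective y = ereal (real_objective y)"
proof -
  have "h i (y $ i) = ereal (real_h i (y $ i))" for i
    using ereal_real_effective_domain[OF h_proper, symmetric] assms
    by (simp add: domain_def direct_sum_def)
  then have "separable_sum h y = (\<Sum>i\<in>UNIV. ereal (real_h i (y $ i)))"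
    unfolding separable_sum_def by (rule sum.cong[OF refl])
  then show ?thesis
    by (simp add: real_objective_def)
qed

lemma objective_infinite: "y \<in> H \<Longrightarrow> y \<notin> domain \<Longrightarrow> objective y = \<infinity>"
  by (auto simp: domain_iff)

lemma lsc_on_objective: "lsc_on H objective"
proof (rule lsc_on_add)
  show "lsc_on H (\<lambda>y. ereal (f y))"
    using f_derivative by (intro lsc_on_continuous has_derivative_continuous_on)
  show "lsc_on H (separable_sum h)"
    by (rule lsc_on_separable_sum[OF h_lsc h_proper])
  show "separable_sum h y \<noteq> -\<infinity>" if "y \<in> H" for y
    using objective_real[of y] that by (cases "y \<in> domain") (auto simp: domain_iff)
qed simp

lemma fb_nth: "fb y $ i = prox (V i) (\<lambda>z. ereal (\<gamma> i) * h i z) (y $ i - \<gamma> i *\<^sub>R grad y $ i)"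
  by (simp add: fb_step_def)

sublocale scaled_h: proper_convex_lsc "V i" "\<lambda>z. ereal (\<gamma> i) * h i z" for i
  using closed_V proper_on_scale[OF h_proper \<gamma>_pos] convex_ereal_on_scale[OF h_convex \<gamma>_pos]
    lsc_on_scale[OF h_lsc less_imp_le[OF \<gamma>_pos]]
  by unfold_locales

lemma fb_mem_domain: "fb y \<in> domain"
  using scaled_h.prox_mem_effective_domain
  by (simp add: domain_def direct_sum_def fb_nth effective_domain_scale[OF \<gamma>_pos])

lemma fb_variational_inequality:
  assumes "z \<in> effective_domain (V i) (h i)"
  shows "\<gamma> i * real_h i (fb y $ i) + inner (y $ i - \<gamma> i *\<^sub>R grad y $ i - fb y $ i) (z - fb y $ i)
    \<le> \<gamma> i * real_h i z"
  using scaled_h.prox_variational_inequality[where z = z and i = i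
      and u = "y $ i - \<gamma> i *\<^sub>R grad y $ i"] assms
  by (simp add: fb_nth effective_domain_scale[OF \<gamma>_pos])

lemma block_change_le:
  assumes z: "z \<in> effective_domain (V i) (h i)"
  shows "block_change y i \<le> real_h i z - real_h i (y $ i) + inner (grad y $ i) (z - y $ i)
    + 1 / \<gamma> i * inner (step y $ i) (z - y $ i) - (2 - \<delta>) / 2 * (1 / \<gamma> i * (norm (step y $ i))\<^sup>2)"
proof -
  define v where "v = step y $ i"
  have fb: "fb y $ i = y $ i + v"
    by (simp add: v_def)
  have "\<gamma> i * real_h i (fb y $ i) + inner (- v - \<gamma> i *\<^sub>R grad y $ i) (z - y $ i - v)
      \<le> \<gamma> i * real_h i z"
    using fb_variational_inequality[OF z, of y] by (simp add: fb algebra_simps)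
  moreover have "inner (- v - \<gamma> i *\<^sub>R grad y $ i) (z - y $ i - v)
      = (norm v)\<^sup>2 - inner v (z - y $ i) - \<gamma> i * inner (grad y $ i) (z - y $ i)
        + \<gamma> i * inner (grad y $ i) v"
    by (simp add: power2_norm_eq_inner inner_commute algebra_simps)
  moreover have "\<gamma> i * \<nu> i * (norm v)\<^sup>2 \<le> \<delta> * (norm v)\<^sup>2"
    using \<gamma>_\<nu>_le by (intro mult_right_mono) auto
  ultimately have "\<gamma> i * block_change y i
      \<le> \<gamma> i * (real_h i z - real_h i (y $ i) + inner (grad y $ i) (z - y $ i))
        + inner v (z - y $ i) - (2 - \<delta>) / 2 * (norm v)\<^sup>2"
    unfolding block_change_def v_def[symmetric] by (simp add: field_simps)
  also have "\<dots> = \<gamma> i * (real_h i z - real_h i (y $ i) + inner (grad y $ i) (z - y $ i)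
      + 1 / \<gamma> i * inner v (z - y $ i) - (2 - \<delta>) / 2 * (1 / \<gamma> i * (norm v)\<^sup>2))"
    using \<gamma>_pos[of i] by (simp add: field_simps)
  finally show ?thesis
    using \<gamma>_pos[of i] unfolding v_def by (simp only: mult_le_cancel_left_pos)
qed

lemma block_change_le_step:
  "y \<in> domain \<Longrightarrow> block_change y i \<le> - ((2 - \<delta>) / 2 * (1 / \<gamma> i * (norm (step y $ i))\<^sup>2))"
  using block_change_le[of "y $ i" i y] by (simp add: domain_def direct_sum_def)

lemma block_change_nonpos:
  assumes "y \<in> domain"
  shows "block_change y i \<le> 0"
proof -
  have "0 \<le> (2 - \<delta>) / 2 * (1 / \<gamma> i * (norm (step y $ i))\<^sup>2)"
    using \<delta>_less_2 \<Gamma>_weight_nonneg by (intro mult_nonneg_nonneg) auto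
  then show ?thesis
    using block_change_le_step[OF assms, of i] by linarith
qed

lemma sum_block_change_le_step:
  assumes "y \<in> domain"
  shows "(\<Sum>i\<in>UNIV. block_change y i) \<le> - ((2 - \<delta>) / 2 * (\<Gamma>_norm (step y))\<^sup>2)"
proof -
  have "(\<Sum>i\<in>UNIV. block_change y i) \<le> (\<Sum>i\<in>UNIV. - ((2 - \<delta>) / 2 * (1 / \<gamma> i * (norm (step y $ i))\<^sup>2)))"
    by (intro sum_mono block_change_le_step assms)
  then show ?thesis
    unfolding wnorm_power2[OF \<Gamma>_weight_nonneg] by (simp only: sum_negf sum_distrib_left)
qed

lemma sum_block_change_le:
  assumes y: "y \<in> domain" and z: "z \<in> domain"
  shows "(\<Sum>i\<in>UNIV. block_change y i) \<le> real_objective z - real_objective y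
    + \<Gamma>_norm (step y) * \<Gamma>_norm (y - z) - (2 - \<delta>) / 2 * (\<Gamma>_norm (step y))\<^sup>2"
proof -
  have y_H: "y \<in> H" and z_H: "z \<in> H"
    using y z domain_subset by auto
  have "(\<Sum>i\<in>UNIV. block_change y i) \<le> (\<Sum>i\<in>UNIV. real_h i (z $ i) - real_h i (y $ i)
    + inner (grad y $ i) ((z - y) $ i) + 1 / \<gamma> i * inner (step y $ i) ((z - y) $ i)
    - (2 - \<delta>) / 2 * (1 / \<gamma> i * (norm (step y $ i))\<^sup>2))"
    unfolding vector_minus_component[of z y]
    using z by (intro sum_mono block_change_le) (simp add: domain_def direct_sum_def)
  also have "\<dots> = (\<Sum>i\<in>UNIV. real_h i (z $ i)) - (\<Sum>i\<in>UNIV. real_h i (y $ i))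
    + inner (grad y) (z - y) + (\<Sum>i\<in>UNIV. 1 / \<gamma> i * inner (step y $ i) ((z - y) $ i))
    - (2 - \<delta>) / 2 * (\<Gamma>_norm (step y))\<^sup>2"
    unfolding wnorm_power2[OF \<Gamma>_weight_nonneg] inner_vec_def
    by (simp only: sum.distrib sum_subtractf sum_distrib_left)
  also have "\<dots> \<le> (\<Sum>i\<in>UNIV. real_h i (z $ i)) - (\<Sum>i\<in>UNIV. real_h i (y $ i))
    + (f z - f y) + \<Gamma>_norm (step y) * \<Gamma>_norm (z - y) - (2 - \<delta>) / 2 * (\<Gamma>_norm (step y))\<^sup>2"
    using convex_on_ge_tangent[OF f_convex f_derivative[OF y_H] y_H z_H]
      wnorm_Cauchy_Schwarz[of "\<lambda>i. 1 / \<gamma> i", OF \<Gamma>_weight_nonneg, of "step y" "z - y"] by linarith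
  finally show ?thesis
    by (simp add: real_objective_def wnorm_minus_commute[of _ z y])
qed

lemma sum_block_change_le_wdist:
  assumes y: "y \<in> domain" and S: "S \<noteq> {}" "S \<subseteq> domain" "\<And>z. z \<in> S \<Longrightarrow> real_objective z = m"
  shows "(\<Sum>i\<in>UNIV. block_change y i) \<le> m - real_objective y - (2 - \<delta>) / 2 * (\<Gamma>_norm (step y))\<^sup>2
    + \<Gamma>_norm (step y) * wdist (\<lambda>i. 1 / \<gamma> i) y S"
  unfolding wdist_def
proof (rule le_add_mult_cINF[OF S(1) wnorm_nonneg[OF \<Gamma>_weight_nonneg]])
  fix z assume "z \<in> S"
  then show "(\<Sum>i\<in>UNIV. block_change y i) \<le> m - real_objective y
      - (2 - \<delta>) / 2 * (\<Gamma>_norm (step y))\<^sup>2 + \<Gamma>_norm (step y) * \<Gamma>_norm (y - z)"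
    using sum_block_change_le[OF y, of z] S by auto
qed

lemma minimizers_iff: "z \<in> minimizers \<longleftrightarrow> z \<in> H \<and> (\<forall>y\<in>H. objective z \<le> objective y)"
  by (auto simp: argmin_set_def is_arg_min_def not_less)

lemma minimizers_subset_domain: "minimizers \<subseteq> domain"
proof
  fix z assume z: "z \<in> minimizers"
  then have "objective z \<le> objective (fb z)"
    using fb_mem_domain[of z] domain_subset by (auto simp: minimizers_iff)
  then have "objective z \<noteq> \<infinity>"
    by (simp add: objective_real[OF fb_mem_domain] del: plus_ereal.simps) auto
  then show "z \<in> domain"
    using z objective_infinite[of z] by (auto simp: minimizers_iff)
qed

lemma INF_objective:
  assumes "minimizers \<noteq> {}"
  shows "(INF y\<in>H. objective y) = ereal min_value"
proof -
  obtain z where z: "z \<in> minimizers"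
    using assms by blast
  then have "(INF y\<in>H. objective y) = objective z"
    by (intro antisym INF_lower INF_greatest) (auto simp: minimizers_iff)
  then show ?thesis
    using z minimizers_subset_domain by (auto simp: min_value_def objective_real)
qed

lemma gap_nonneg:
  assumes "minimizers \<noteq> {}" "y \<in> domain"
  shows "0 \<le> gap y"
proof -
  have "ereal min_value \<le> objective y"
    unfolding INF_objective[OF assms(1), symmetric] using assms(2) domain_subset
    by (auto intro: INF_lower)
  then show ?thesis
    by (simp add: gap_def objective_real[OF assms(2)])
qed

lemma mem_minimizers_iff:
  assumes "minimizers \<noteq> {}"
  shows "z \<in> minimizers \<longleftrightarrow> z \<in> H \<and> objective z \<le> ereal min_value"
  unfolding minimizers_iff INF_objective[OF assms, symmetric] by (auto simp: le_INF_iff)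

lemma gap_minimizer:
  assumes "z \<in> minimizers"
  shows "gap z = 0"
proof -
  have "z \<in> domain"
    using assms minimizers_subset_domain by auto
  moreover have "objective z \<le> ereal min_value"
    using assms mem_minimizers_iff by auto
  ultimately show ?thesis
    using gap_nonneg[of z] assms by (force simp: objective_real gap_def)
qed

lemma minimizer_of_gap_LIMSEQ:
  assumes nonempty: "minimizers \<noteq> {}"
    and u: "\<And>n. u n \<in> domain" "u \<longlonglongrightarrow> z" "(\<lambda>n. gap (u n)) \<longlonglongrightarrow> 0"
  shows "z \<in> minimizers"
  unfolding mem_minimizers_iff[OF nonempty]
proof
  show z: "z \<in> H"
    using closed_sequentially[OF closed_H _ u(2)] u(1) domain_subset by auto
  have "(\<lambda>n. gap (u n) + min_value) \<longlonglongrightarrow> 0 + min_value"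
    by (intro tendsto_intros u(3))
  then have "(\<lambda>n. objective (u n)) \<longlonglongrightarrow> ereal min_value"
    by (simp add: objective_real[OF u(1)] gap_def)
  then show "objective z \<le> ereal min_value"
    using u(1) domain_subset by (intro lsc_onD_tendsto[OF lsc_on_objective _ z u(2)]) auto
qed

lemma sum_block_change_le_error_bound:
  assumes y: "y \<in> domain" and "0 < c" and nonempty: "minimizers \<noteq> {}"
    and error_bound: "wdist (\<lambda>i. 1 / \<gamma> i) y minimizers \<le> c * \<Gamma>_norm (y - fb y)"
  shows "(\<Sum>i\<in>UNIV. block_change y i) \<le> - (min 1 ((2 - \<delta>) / (2 * c)) * gap y)"
proof -
  define D where "D = \<Gamma>_norm (step y)"
  have "(\<Sum>i\<in>UNIV. block_change y i)
      \<le> min_value - real_objective y - (2 - \<delta>) / 2 * D\<^sup>2 + D * wdist (\<lambda>i. 1 / \<gamma> i) y minimizers"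
    unfolding D_def using nonempty minimizers_subset_domain gap_minimizer
    by (intro sum_block_change_le_wdist[OF y]) (auto simp: gap_def)
  also have "D * wdist (\<lambda>i. 1 / \<gamma> i) y minimizers \<le> D * (c * D)"
    using error_bound wnorm_nonneg[OF \<Gamma>_weight_nonneg] unfolding D_def wnorm_minus_commute[of _ y]
    by (intro mult_left_mono) auto
  finally have "(\<Sum>i\<in>UNIV. block_change y i) \<le> - gap y + (c - (2 - \<delta>) / 2) * D\<^sup>2"
    by (simp add: gap_def power2_eq_square algebra_simps)
  then have "(\<Sum>i\<in>UNIV. block_change y i) \<le> - (min 1 ((2 - \<delta>) / 2 / c) * gap y)"
    using sum_block_change_le_step[OF y] \<open>0 < c\<close> \<delta>_less_2
    by (intro le_neg_min_mult[of _ c "D\<^sup>2"]) (auto simp: D_def)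
  then show ?thesis by simp
qed

end

section \<open>One random block update\<close>

lemma integral_of_bool:
  "(\<integral>\<omega>. of_bool (P \<omega>) \<partial>M) = measure M {\<omega> \<in> space M. P \<omega>}"
proof -
  have "(\<integral>\<omega>. (of_bool (P \<omega>) :: real) \<partial>M) = (\<integral>\<omega>. indicator {\<omega> \<in> space M. P \<omega>} \<omega> \<partial>M)"
    by (intro Bochner_Integration.integral_cong) (auto simp: indicator_def)
  also have "\<dots> = measure M ({\<omega> \<in> space M. P \<omega>} \<inter> space M)"
    by simp
  also have "{\<omega> \<in> space M. P \<omega>} \<inter> space M = {\<omega> \<in> space M. P \<omega>}"
    by auto
  finally show ?thesis .
qed

definition block_update ::
  "('m::finite \<Rightarrow> 'a::real_normed_vector set) \<Rightarrow> ('m \<Rightarrow> 'a \<Rightarrow> ereal) \<Rightarrow> ('a ^ 'm \<Rightarrow> 'a ^ 'm)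
    \<Rightarrow> ('m \<Rightarrow> real) \<Rightarrow> 'a ^ 'm \<Rightarrow> ('m \<Rightarrow> bool) \<Rightarrow> 'a ^ 'm" where
  "block_update V h grad \<gamma> y e = y + e \<odot> (fb_step V h grad \<gamma> y - y)"

locale sampled_block_composite = block_composite V f grad h \<gamma> \<nu> \<delta> + prob_space M
  for V :: "'m::finite \<Rightarrow> 'a::{real_inner, banach} set" and f grad h \<gamma> \<nu> \<delta>
    and M :: "'w measure" +
  fixes \<epsilon> :: "'w \<Rightarrow> 'm \<Rightarrow> bool" and p :: "'m \<Rightarrow> real" and p_min :: real
  assumes measurable_selection: "\<epsilon> \<in> measurable M (count_space UNIV)"
    and selection_prob: "\<And>i. p i = prob {\<omega> \<in> space M. \<epsilon> \<omega> i}"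
    and p_min_pos: "0 < p_min" and p_min_le: "\<And>i. p_min \<le> p i"
    and smooth: "\<And>y v. y \<in> direct_sum V \<Longrightarrow> v \<in> direct_sum V \<Longrightarrow>
      expectation (\<lambda>\<omega>. f (y + \<epsilon> \<omega> \<odot> v))
        \<le> f y + expectation (\<lambda>\<omega>. inner (grad y) (\<epsilon> \<omega> \<odot> v))
          + 1 / 2 * (\<Sum>i\<in>UNIV. p i * \<nu> i * (norm (v $ i))\<^sup>2)"
begin

abbreviation update :: "'a ^ 'm \<Rightarrow> ('m \<Rightarrow> bool) \<Rightarrow> 'a ^ 'm" where
  "update \<equiv> block_update V h grad \<gamma>"

abbreviation W :: "'m \<Rightarrow> real" where
  "W \<equiv> \<lambda>i. 1 / (\<gamma> i * p i)"

definition expected_gap :: "'a ^ 'm \<Rightarrow> real" where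
  "expected_gap y = expectation (\<lambda>\<omega>. gap (update y (\<epsilon> \<omega>)))"

lemma p_pos: "0 < p i"
  using p_min_pos p_min_le less_le_trans by blast

lemma p_min_le_1: "p_min \<le> 1"
  using p_min_le[of undefined] prob_le_1 order_trans unfolding selection_prob by blast

lemma W_pos: "0 < W i"
  using \<gamma>_pos p_pos by simp

lemma W_nonneg: "0 \<le> W i"
  using W_pos less_imp_le by blast

lemma integrable_selection:
  fixes g :: "('m \<Rightarrow> bool) \<Rightarrow> real"
  shows "integrable M (\<lambda>\<omega>. g (\<epsilon> \<omega>))"
  by (rule integrable_finite_range[OF measurable_selection]) (rule finite)

lemma expectation_selected_sum:
  "expectation (\<lambda>\<omega>. \<Sum>i\<in>UNIV. of_bool (\<epsilon> \<omega> i) * r i) = (\<Sum>i\<in>UNIV. p i * r i)"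
proof -
  have "expectation (\<lambda>\<omega>. \<Sum>i\<in>UNIV. of_bool (\<epsilon> \<omega> i) * r i)
      = (\<Sum>i\<in>UNIV. expectation (\<lambda>\<omega>. of_bool (\<epsilon> \<omega> i) * r i))"
    by (rule Bochner_Integration.integral_sum) (rule integrable_selection)
  then show ?thesis
    by (simp add: integral_of_bool selection_prob)
qed

lemma update_nth: "update y e $ i = (if e i then fb y $ i else y $ i)"
  by (simp add: block_update_def block_select_def)

lemma update_mem_domain: "y \<in> domain \<Longrightarrow> update y e \<in> domain"
  using fb_mem_domain[of y] by (simp add: domain_def direct_sum_def update_nth)

lemma expectation_wnorm_power2_update:
  "expectation (\<lambda>\<omega>. (wnorm W (update y (\<epsilon> \<omega>) - y))\<^sup>2) = (\<Gamma>_norm (step y))\<^sup>2"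
proof -
  have "(wnorm W (update y e - y))\<^sup>2 = (\<Sum>i\<in>UNIV. of_bool (e i) * (W i * (norm (step y $ i))\<^sup>2))" for e
    unfolding wnorm_power2[OF W_nonneg] by (intro sum.cong) (auto simp: update_nth)
  then have "expectation (\<lambda>\<omega>. (wnorm W (update y (\<epsilon> \<omega>) - y))\<^sup>2)
      = (\<Sum>i\<in>UNIV. p i * (W i * (norm (step y $ i))\<^sup>2))"
    by (simp only: expectation_selected_sum)
  also have "\<dots> = (\<Sum>i\<in>UNIV. 1 / \<gamma> i * (norm (step y $ i))\<^sup>2)"
    using p_pos by (intro sum.cong) (simp_all add: less_imp_neq[THEN not_sym])
  finally show ?thesis
    unfolding wnorm_power2[OF \<Gamma>_weight_nonneg] .
qed

lemma expectation_f_update_le: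
  assumes y: "y \<in> H"
  shows "expectation (\<lambda>\<omega>. f (update y (\<epsilon> \<omega>)))
    \<le> f y + (\<Sum>i\<in>UNIV. p i * (inner (grad y $ i) (step y $ i) + \<nu> i / 2 * (norm (step y $ i))\<^sup>2))"
proof -
  have "step y \<in> H"
    using y fb_mem_domain domain_subset by (intro subspace_diff[OF subspace_H]) auto
  then have "expectation (\<lambda>\<omega>. f (update y (\<epsilon> \<omega>)))
      \<le> f y + expectation (\<lambda>\<omega>. inner (grad y) (\<epsilon> \<omega> \<odot> step y))
        + 1 / 2 * (\<Sum>i\<in>UNIV. p i * \<nu> i * (norm (step y $ i))\<^sup>2)"
    unfolding block_update_def by (rule smooth[OF y])
  also have "expectation (\<lambda>\<omega>. inner (grad y) (\<epsilon> \<omega> \<odot> step y))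
      = (\<Sum>i\<in>UNIV. p i * inner (grad y $ i) (step y $ i))"
    unfolding inner_vec_def block_select_def vec_lambda_beta inner_scaleR_right
    by (rule expectation_selected_sum)
  finally show ?thesis
    by (simp add: sum.distrib sum_distrib_left distrib_left mult_ac del: vector_minus_component)
qed

lemma expectation_real_h_update:
  "expectation (\<lambda>\<omega>. \<Sum>i\<in>UNIV. real_h i (update y (\<epsilon> \<omega>) $ i))
    = (\<Sum>i\<in>UNIV. real_h i (y $ i)) + (\<Sum>i\<in>UNIV. p i * (real_h i (fb y $ i) - real_h i (y $ i)))"
proof -
  let ?r = "\<lambda>i. real_h i (fb y $ i) - real_h i (y $ i)"
  have "(\<Sum>i\<in>UNIV. real_h i (update y e $ i))
      = (\<Sum>i\<in>UNIV. real_h i (y $ i)) + (\<Sum>i\<in>UNIV. of_bool (e i) * ?r i)" for e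
    unfolding sum.distrib[symmetric] by (intro sum.cong) (simp_all add: update_nth)
  then have "expectation (\<lambda>\<omega>. \<Sum>i\<in>UNIV. real_h i (update y (\<epsilon> \<omega>) $ i))
      = expectation (\<lambda>\<omega>. (\<Sum>i\<in>UNIV. real_h i (y $ i)) + (\<Sum>i\<in>UNIV. of_bool (\<epsilon> \<omega> i) * ?r i))"
    by simp
  also have "\<dots> = expectation (\<lambda>\<omega>. \<Sum>i\<in>UNIV. real_h i (y $ i))
      + expectation (\<lambda>\<omega>. \<Sum>i\<in>UNIV. of_bool (\<epsilon> \<omega> i) * ?r i)"
    by (intro Bochner_Integration.integral_add integrable_const
        integrable_selection[of "\<lambda>e. \<Sum>i\<in>UNIV. of_bool (e i) * ?r i"])
  also have "\<dots> = (\<Sum>i\<in>UNIV. real_h i (y $ i)) + (\<Sum>i\<in>UNIV. p i * ?r i)"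
    unfolding expectation_selected_sum by (simp add: prob_space)
  finally show ?thesis .
qed

lemma expected_gap_le_sum_block_change:
  assumes y: "y \<in> domain"
  shows "expected_gap y \<le> gap y + p_min * (\<Sum>i\<in>UNIV. block_change y i)"
proof -
  have "expected_gap y = expectation (\<lambda>\<omega>. f (update y (\<epsilon> \<omega>)))
      + expectation (\<lambda>\<omega>. \<Sum>i\<in>UNIV. real_h i (update y (\<epsilon> \<omega>) $ i)) - min_value"
    unfolding expected_gap_def gap_def real_objective_def
    using integrable_selection[of "\<lambda>e. f (update y e)"]
      integrable_selection[of "\<lambda>e. \<Sum>i\<in>UNIV. real_h i (update y e $ i)"]
    by (simp add: prob_space)
  also have "\<dots> \<le> gap y
      + (\<Sum>i\<in>UNIV. p i * (inner (grad y $ i) (step y $ i) + \<nu> i / 2 * (norm (step y $ i))\<^sup>2))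
      + (\<Sum>i\<in>UNIV. p i * (real_h i (fb y $ i) - real_h i (y $ i)))"
    using expectation_f_update_le[of y] y domain_subset
    unfolding expectation_real_h_update gap_def real_objective_def by auto
  also have "\<dots> = gap y + (\<Sum>i\<in>UNIV. p i * block_change y i)"
    by (simp add: block_change_def algebra_simps flip: sum.distrib del: vector_minus_component)
  also have "(\<Sum>i\<in>UNIV. p i * block_change y i) \<le> (\<Sum>i\<in>UNIV. p_min * block_change y i)"
    using p_min_le block_change_nonpos[OF y] by (intro sum_mono mult_right_mono_neg)
  finally show ?thesis
    by (simp add: sum_distrib_left)
qed

lemma step_le_expected_gap_decrease:
  assumes y: "y \<in> domain"
  shows "(2 - \<delta>) / 2 * p_min * (\<Gamma>_norm (step y))\<^sup>2 \<le> gap y - expected_gap y"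
  using expected_gap_le_sum_block_change[OF y]
    mult_left_mono[OF sum_block_change_le_step[OF y] less_imp_le[OF p_min_pos]]
  by (simp add: algebra_simps)

lemma expected_gap_contraction:
  assumes y: "y \<in> domain" and "0 < c" "minimizers \<noteq> {}"
    and "wdist (\<lambda>i. 1 / \<gamma> i) y minimizers \<le> c * \<Gamma>_norm (y - fb y)"
  shows "expected_gap y \<le> (1 - p_min * min 1 ((2 - \<delta>) / (2 * c))) * gap y"
  using expected_gap_le_sum_block_change[OF y]
    mult_left_mono[OF sum_block_change_le_error_bound[OF assms] less_imp_le[OF p_min_pos]]
  by (simp add: algebra_simps)

end

section \<open>Linear convergence\<close>

locale random_forward_backward =
  sampled_block_composite V f grad h \<gamma> \<nu> \<delta> M \<epsilon> p p_min +
  random_iteration M "block_update V h grad \<gamma>" x0 \<epsilon> eps x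
  for V :: "'m::finite \<Rightarrow> 'a::{real_inner, banach, second_countable_topology} set"
    and f grad h \<gamma> \<nu> \<delta> and M :: "'w measure" and \<epsilon> p p_min x0 eps x +
  fixes X :: "('a ^ 'm) set" and c :: real
  assumes x0_feasible: "x0 \<in> direct_sum V" "separable_sum h x0 < \<infinity>"
    and minimizers_nonempty: "minimizers \<noteq> {}"
    and iterates_in_X: "AE \<omega> in M. \<forall>n. x n \<omega> \<in> X"
    and c_pos: "0 < c"
    and error_bound: "\<And>y. y \<in> X \<Longrightarrow>
      wdist (\<lambda>i. 1 / \<gamma> i) y minimizers \<le> c * wnorm (\<lambda>i. 1 / \<gamma> i) (y - fb_step V h grad \<gamma> y)"
begin

definition rate :: real where
  "rate = 1 - p_min * min 1 ((2 - \<delta>) / (2 * c))"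

definition mean_gap :: "nat \<Rightarrow> real" where
  "mean_gap n = expectation (\<lambda>\<omega>. gap (x n \<omega>))"

definition increment :: "nat \<Rightarrow> 'w \<Rightarrow> real" where
  "increment n \<omega> = wnorm W (x (Suc n) \<omega> - x n \<omega>)"

definition increment_constant :: real where
  "increment_constant = sqrt (mean_gap 0 / ((2 - \<delta>) / 2 * p_min))"

lemma rate_nonneg: "0 \<le> rate"
  using mult_mono[OF p_min_le_1, of "min 1 ((2 - \<delta>) / (2 * c))" 1] p_min_pos \<delta>_less_2 c_pos
  by (simp add: rate_def)

lemma rate_less_1: "rate < 1"
  using p_min_pos \<delta>_less_2 c_pos by (simp add: rate_def)

lemma sqrt_rate: "0 \<le> sqrt rate" "sqrt rate < 1"
  using rate_nonneg rate_less_1 by auto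

lemma iterate_mem_domain:
  assumes "\<omega> \<in> space M"
  shows "x n \<omega> \<in> domain"
proof (induction n)
  case 0
  then show ?case
    using x0_feasible assms by (simp add: iterate_0 domain_iff)
next
  case (Suc n)
  then show ?case
    using assms by (simp add: iterate_Suc update_mem_domain)
qed

lemma gap_iterate_nonneg: "\<omega> \<in> space M \<Longrightarrow> 0 \<le> gap (x n \<omega>)"
  by (intro gap_nonneg minimizers_nonempty iterate_mem_domain)

lemma mean_gap_nonneg: "0 \<le> mean_gap n"
  unfolding mean_gap_def by (intro Bochner_Integration.integral_nonneg gap_iterate_nonneg)

lemma mean_gap_Suc: "mean_gap (Suc n) = expectation (\<lambda>\<omega>. expected_gap (x n \<omega>))"
proof -
  have "mean_gap (Suc n) = expectation (\<lambda>\<omega>. gap (update (x n \<omega>) (eps n \<omega>)))"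
    unfolding mean_gap_def by (intro Bochner_Integration.integral_cong) (simp_all add: iterate_Suc)
  then show ?thesis
    unfolding expected_gap_def by (simp only: expectation_iterate_eps[of "\<lambda>y e. gap (update y e)"])
qed

lemma mean_gap_le: "mean_gap n \<le> rate ^ n * mean_gap 0"
proof (induction n)
  case (Suc n)
  have "mean_gap (Suc n) \<le> expectation (\<lambda>\<omega>. rate * gap (x n \<omega>))"
    unfolding mean_gap_Suc
  proof (rule integral_mono_AE)
    show "AE \<omega> in M. expected_gap (x n \<omega>) \<le> rate * gap (x n \<omega>)"
      unfolding rate_def using iterates_in_X AE_space
    proof eventually_elim
      case (elim \<omega>)
      then show ?case
        by (intro expected_gap_contraction iterate_mem_domain c_pos minimizers_nonempty error_bound)
          auto
    qed
  qed (rule integrable_iterate)+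
  also have "\<dots> = rate * mean_gap n"
    unfolding mean_gap_def by (rule integral_mult_right_zero)
  also have "\<dots> \<le> rate * (rate ^ n * mean_gap 0)"
    by (rule mult_left_mono[OF Suc rate_nonneg])
  finally show ?case
    by (simp only: power_Suc mult.assoc)
qed simp

lemma AE_gap_LIMSEQ: "AE \<omega> in M. (\<lambda>n. gap (x n \<omega>)) \<longlonglongrightarrow> 0"
proof -
  have "summable (\<lambda>n. rate ^ n * mean_gap 0)"
    using rate_nonneg rate_less_1 by (intro summable_mult2 summable_geometric) simp
  then have "summable mean_gap"
    by (rule summable_comparison_test[rotated]) (use mean_gap_nonneg mean_gap_le in auto)
  moreover have "expectation (\<lambda>\<omega>. norm (gap (x n \<omega>))) = mean_gap n" for n
    unfolding mean_gap_def
    by (intro Bochner_Integration.integral_cong) (simp_all add: gap_iterate_nonneg)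
  ultimately have "AE \<omega> in M. summable (\<lambda>n. norm (gap (x n \<omega>)))"
    by (intro AE_summable_norm integrable_iterate) simp
  then show ?thesis
    by eventually_elim (rule tendsto_norm_zero_cancel[OF summable_LIMSEQ_zero])
qed

lemma ereal_expectation_gap:
  "ereal_expectation M (\<lambda>\<omega>. objective (x n \<omega>)) - (INF y\<in>H. objective y) = ereal (mean_gap n)"
proof -
  have "ereal_expectation M (\<lambda>\<omega>. objective (x n \<omega>))
      = ereal (expectation (\<lambda>\<omega>. real_objective (x n \<omega>)))"
    by (intro ereal_expectation_ereal integrable_iterate objective_real iterate_mem_domain)
  then show ?thesis
    unfolding INF_objective[OF minimizers_nonempty] mean_gap_def gap_def
    by (simp add: integrable_iterate prob_space)
qed

theorem objective_linear_rate:
  "ereal_expectation M (\<lambda>\<omega>. objective (x n \<omega>)) - (INF y\<in>H. objective y)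
    \<le> ereal (rate ^ n) * (ereal_expectation M (\<lambda>\<omega>. objective (x 0 \<omega>)) - (INF y\<in>H. objective y))"
  unfolding ereal_expectation_gap using mean_gap_le by simp

lemma increment_nonneg: "0 \<le> increment n \<omega>"
  unfolding increment_def by (rule wnorm_nonneg[OF W_nonneg])

lemma expectation_increment_nonneg: "0 \<le> expectation (increment n)"
  by (intro Bochner_Integration.integral_nonneg increment_nonneg)

lemma increment_eq_update:
  "\<omega> \<in> space M \<Longrightarrow> increment n \<omega> = wnorm W (update (x n \<omega>) (eps n \<omega>) - x n \<omega>)"
  by (simp add: increment_def iterate_Suc)

lemma integrable_increment: "integrable M (increment n)"
  using integrable_iterate_eps[of "\<lambda>y e. wnorm W (update y e - y)" n]
  by (simp add: increment_eq_update cong: Bochner_Integration.integrable_cong)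

lemma integrable_increment_power2: "integrable M (\<lambda>\<omega>. (increment n \<omega>)\<^sup>2)"
  using integrable_iterate_eps[of "\<lambda>y e. (wnorm W (update y e - y))\<^sup>2" n]
  by (simp add: increment_eq_update cong: Bochner_Integration.integrable_cong)

lemma expectation_increment_power2:
  "expectation (\<lambda>\<omega>. (increment n \<omega>)\<^sup>2) = expectation (\<lambda>\<omega>. (\<Gamma>_norm (step (x n \<omega>)))\<^sup>2)"
proof -
  have "expectation (\<lambda>\<omega>. (increment n \<omega>)\<^sup>2)
      = expectation (\<lambda>\<omega>. (wnorm W (update (x n \<omega>) (eps n \<omega>) - x n \<omega>))\<^sup>2)"
    by (intro Bochner_Integration.integral_cong) (simp_all only: increment_eq_update)
  then show ?thesis
    unfolding expectation_iterate_eps[of "\<lambda>y e. (wnorm W (update y e - y))\<^sup>2"]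
      expectation_wnorm_power2_update .
qed

lemma expectation_increment_power2_le:
  "(2 - \<delta>) / 2 * p_min * expectation (\<lambda>\<omega>. (increment n \<omega>)\<^sup>2) \<le> mean_gap n"
proof -
  have "(2 - \<delta>) / 2 * p_min * expectation (\<lambda>\<omega>. (increment n \<omega>)\<^sup>2)
      = expectation (\<lambda>\<omega>. (2 - \<delta>) / 2 * p_min * (\<Gamma>_norm (step (x n \<omega>)))\<^sup>2)"
    by (simp add: expectation_increment_power2)
  also have "\<dots> \<le> expectation (\<lambda>\<omega>. gap (x n \<omega>) - expected_gap (x n \<omega>))"
    by (intro integral_mono step_le_expected_gap_decrease iterate_mem_domain
        integrable_iterate[of "\<lambda>y. (2 - \<delta>) / 2 * p_min * (\<Gamma>_norm (step y))\<^sup>2"]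
        integrable_iterate[of "\<lambda>y. gap y - expected_gap y"])
  also have "\<dots> = mean_gap n - mean_gap (Suc n)"
    unfolding mean_gap_Suc unfolding mean_gap_def
    by (intro Bochner_Integration.integral_diff integrable_iterate)
  also have "\<dots> \<le> mean_gap n"
    using mean_gap_nonneg[of "Suc n"] by simp
  finally show ?thesis .
qed

lemma expectation_increment_le: "expectation (increment n) \<le> increment_constant * sqrt rate ^ n"
proof -
  define a where "a = (2 - \<delta>) / 2 * p_min"
  have a: "0 < a"
    using \<delta>_less_2 p_min_pos by (simp add: a_def)
  have "a * expectation (\<lambda>\<omega>. (increment n \<omega>)\<^sup>2) \<le> rate ^ n * mean_gap 0"
    unfolding a_def by (rule order_trans[OF expectation_increment_power2_le mean_gap_le])
  then have "expectation (\<lambda>\<omega>. (increment n \<omega>)\<^sup>2) \<le> mean_gap 0 / a * rate ^ n"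
    using a by (simp add: pos_le_divide_eq mult.commute)
  then have "sqrt (expectation (\<lambda>\<omega>. (increment n \<omega>)\<^sup>2)) \<le> sqrt (mean_gap 0 / a * rate ^ n)"
    by (rule real_sqrt_le_mono)
  also have "\<dots> = increment_constant * sqrt rate ^ n"
    unfolding increment_constant_def a_def real_sqrt_mult real_sqrt_power ..
  finally show ?thesis
    using expectation_le_sqrt_expectation_power2
      [OF integrable_increment integrable_increment_power2]
    by (rule order_trans[rotated])
qed

lemmas summable_expectation_increment =
  summable_of_geometric_bound[OF expectation_increment_nonneg expectation_increment_le sqrt_rate]

lemmas expectation_increment_tail_le =
  suminf_tail_le_geometric[OF expectation_increment_nonneg expectation_increment_le sqrt_rate]

lemma norm_block_scale_diff: "norm (block_scale W y - block_scale W z) = wnorm W (y - z)"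
  by (simp add: wnorm_eq_norm_block_scale[OF W_nonneg] block_scale_diff)

lemma norm_block_scale_increment:
  "norm (block_scale W (x (Suc n) \<omega>) - block_scale W (x n \<omega>)) = increment n \<omega>"
  unfolding increment_def by (rule norm_block_scale_diff)

lemma AE_iterates_convergent: "AE \<omega> in M. convergent (\<lambda>n. x n \<omega>)"
proof -
  have "AE \<omega> in M. convergent (\<lambda>n. block_scale W (x n \<omega>))"
    using integrable_increment summable_expectation_increment
    by (intro AE_convergent_of_summable_increments) (simp_all only: norm_block_scale_increment)
  then show ?thesis
  proof eventually_elim
    case (elim \<omega>)
    then obtain l where "(\<lambda>n. block_scale W (x n \<omega>)) \<longlonglongrightarrow> l"
      by (auto simp: convergent_def)
    then have "(\<lambda>n. block_scale (\<lambda>i. inverse (W i)) (block_scale W (x n \<omega>)))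
        \<longlonglongrightarrow> block_scale (\<lambda>i. inverse (W i)) l"
      by (rule tendsto_block_scale)
    then show ?case
      unfolding block_scale_inverse[of W, OF W_pos] by (rule convergentI)
  qed
qed

lemma AE_iterates_LIMSEQ_minimizer: "AE \<omega> in M. \<exists>z\<in>minimizers. (\<lambda>n. x n \<omega>) \<longlonglongrightarrow> z"
  using AE_iterates_convergent AE_gap_LIMSEQ AE_space
proof eventually_elim
  case (elim \<omega>)
  then obtain z where z: "(\<lambda>n. x n \<omega>) \<longlonglongrightarrow> z"
    by (auto simp: convergent_def)
  have "z \<in> minimizers"
    using minimizer_of_gap_LIMSEQ[OF minimizers_nonempty iterate_mem_domain z] elim by simp
  then show ?case
    using z by blast
qed

lemma borel_measurable_iterate: "x n \<in> borel_measurable M"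
  using measurable_compose[OF measurable_iterate, of "\<lambda>y. y" borel] by simp

lemma
  assumes l: "l \<in> borel_measurable M" "AE \<omega> in M. (\<lambda>n. x n \<omega>) \<longlonglongrightarrow> l \<omega>"
  shows integrable_wnorm_diff_limit: "integrable M (\<lambda>\<omega>. wnorm W (x n \<omega> - l \<omega>))"
    and expectation_wnorm_diff_limit_le: "expectation (\<lambda>\<omega>. wnorm W (x n \<omega> - l \<omega>))
      \<le> increment_constant / (1 - sqrt rate) * sqrt rate ^ n"
proof -
  have "AE \<omega> in M. (\<lambda>n. block_scale W (x n \<omega>)) \<longlonglongrightarrow> block_scale W (l \<omega>)"
    using l(2) by eventually_elim (rule tendsto_block_scale)
  note limits = integrable_norm_diff_limit[OF _ _ this, of n]
    integral_norm_diff_limit_le[OF _ _ this, of n]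
  note limits_wnorm = limits[unfolded norm_block_scale_diff,
      folded increment_def, OF integrable_increment summable_expectation_increment
        borel_measurable_wnorm_diff[OF borel_measurable_iterate l(1)]]
  show "integrable M (\<lambda>\<omega>. wnorm W (x n \<omega> - l \<omega>))"
    by (rule limits_wnorm(1))
  show "expectation (\<lambda>\<omega>. wnorm W (x n \<omega> - l \<omega>))
      \<le> increment_constant / (1 - sqrt rate) * sqrt rate ^ n"
    using limits_wnorm(2) expectation_increment_tail_le by (rule order_trans)
qed

theorem iterates_linear_rate:
  "\<exists>xs. xs \<in> borel_measurable M \<and> (\<forall>\<omega>\<in>space M. xs \<omega> \<in> minimizers)
    \<and> (AE \<omega> in M. (\<lambda>n. x n \<omega>) \<longlonglongrightarrow> xs \<omega>)
    \<and> (\<forall>n. integrable M (\<lambda>\<omega>. wnorm W (x n \<omega> - xs \<omega>)))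
    \<and> (\<lambda>n. expectation (\<lambda>\<omega>. wnorm W (x n \<omega> - xs \<omega>))) \<in> O(\<lambda>n. rate powr (real n / 2))"
proof -
  obtain s where "s \<in> minimizers"
    using minimizers_nonempty by blast
  then obtain xs where xs: "xs \<in> borel_measurable M" "\<And>\<omega>. \<omega> \<in> space M \<Longrightarrow> xs \<omega> \<in> minimizers"
    "AE \<omega> in M. (\<lambda>n. x n \<omega>) \<longlonglongrightarrow> xs \<omega>"
    using borel_measurable_AE_limit_in[OF borel_measurable_iterate AE_iterates_LIMSEQ_minimizer]
    by blast
  have "0 \<le> expectation (\<lambda>\<omega>. wnorm W (x n \<omega> - xs \<omega>))" for n
    by (intro Bochner_Integration.integral_nonneg wnorm_nonneg W_nonneg)
  then have "(\<lambda>n. expectation (\<lambda>\<omega>. wnorm W (x n \<omega> - xs \<omega>))) \<in> O(\<lambda>n. rate powr (real n / 2))"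
    using expectation_wnorm_diff_limit_le[OF xs(1,3)]
    by (intro bigo_powr_half[where C = "increment_constant / (1 - sqrt rate)"] rate_nonneg) simp
  then show ?thesis
    using xs integrable_wnorm_diff_limit[OF xs(1,3)] by blast
qed

end

theorem theorem4p16:
  fixes V :: "'m::finite \<Rightarrow> 'a::{real_inner, banach, second_countable_topology} set"
    and f :: "'a ^ 'm \<Rightarrow> real"
    and grad :: "'a ^ 'm \<Rightarrow> 'a ^ 'm"
    and h :: "'m \<Rightarrow> 'a \<Rightarrow> ereal"
    and M :: "'w measure"
    and \<epsilon> :: "'w \<Rightarrow> 'm \<Rightarrow> bool"
    and eps :: "nat \<Rightarrow> 'w \<Rightarrow> 'm \<Rightarrow> bool"
    and \<nu> \<gamma> :: "'m \<Rightarrow> real"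
    and x0 :: "'a ^ 'm"
    and x :: "nat \<Rightarrow> 'w \<Rightarrow> 'a ^ 'm"
    and X :: "('a ^ 'm) set"
    and c :: real
  defines "H \<equiv> direct_sum V"
    and "F \<equiv> (\<lambda>y. ereal (f y) + separable_sum h y)"
    and "p \<equiv> (\<lambda>i. measure M {\<omega> \<in> space M. \<epsilon> \<omega> i})"
    and "\<delta> \<equiv> Max (range (\<lambda>i. \<gamma> i * \<nu> i))"
  defines "p_min \<equiv> Min (range p)"
    and "F_min \<equiv> (INF y\<in>H. F y)"
    and "S_min \<equiv> argmin_set F H"
  defines "rate \<equiv> 1 - p_min * min 1 ((2 - \<delta>) / (2 * c))"
  assumes V: "\<And>i. subspace (V i)" "\<And>i. closed (V i)"
    and f_convex: "convex_on H f"
    and f_gradient: "\<And>y. y \<in> H \<Longrightarrow> grad y \<in> H"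
      "\<And>y. y \<in> H \<Longrightarrow> (f has_derivative (\<lambda>v. inner (grad y) v)) (at y within H)"
    and h: "\<And>i. proper_on (V i) (h i)" "\<And>i. convex_ereal_on (V i) (h i)" "\<And>i. lsc_on (V i) (h i)"
    and M: "prob_space M"
    and \<epsilon>: "\<epsilon> \<in> measurable M (count_space UNIV)"
      "\<And>i. p i > 0"
      "measure M {\<omega> \<in> space M. \<epsilon> \<omega> = (\<lambda>i. False)} = 0"
    and eps_indep: "prob_space.indep_vars M (\<lambda>n. count_space UNIV) eps UNIV"
    and eps_copies: "\<And>n. distr M (count_space UNIV) (eps n) = distr M (count_space UNIV) \<epsilon>"
    and \<nu>_pos: "\<And>i. \<nu> i > 0"
    and smooth: "\<And>y v. y \<in> H \<Longrightarrow> v \<in> H \<Longrightarrow>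
      (\<integral>\<omega>. f (y + \<epsilon> \<omega> \<odot> v) \<partial>M)
        \<le> f y + (\<integral>\<omega>. inner (grad y) (\<epsilon> \<omega> \<odot> v) \<partial>M)
            + 1 / 2 * (\<Sum>i\<in>UNIV. p i * \<nu> i * (norm (v $ i))\<^sup>2)"
    and \<gamma>: "\<And>i. 0 < \<gamma> i" "\<And>i. \<gamma> i < 2 / \<nu> i"
    and x0: "x0 \<in> H" "separable_sum h x0 < \<infinity>"
    and x_0: "\<And>\<omega>. \<omega> \<in> space M \<Longrightarrow> x 0 \<omega> = x0"
    and x_Suc: "\<And>n \<omega> i. \<omega> \<in> space M \<Longrightarrow>
      x (Suc n) \<omega> $ i = x n \<omega> $ i + of_bool (eps n \<omega> i) *\<^sub>R
        (prox (V i) (\<lambda>z. ereal (\<gamma> i) * h i z) (x n \<omega> $ i - \<gamma> i *\<^sub>R grad (x n \<omega>) $ i) - x n \<omega> $ i)"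
    and S_min: "S_min \<noteq> {}"
    and X: "X \<subseteq> H" "AE \<omega> in M. \<forall>n. x n \<omega> \<in> X"
    and c: "c > 0"
    and error_bound: "\<And>y. y \<in> X \<Longrightarrow>
      wdist (\<lambda>i. 1 / \<gamma> i) y S_min \<le> c * wnorm (\<lambda>i. 1 / \<gamma> i) (y - fb_step V h grad \<gamma> y)"
  shows "(\<forall>n. ereal_expectation M (\<lambda>\<omega>. F (x n \<omega>)) - F_min
              \<le> ereal (rate ^ n) * (ereal_expectation M (\<lambda>\<omega>. F (x 0 \<omega>)) - F_min))
       \<and> (\<exists>xs. xs \<in> borel_measurable M \<and> (\<forall>\<omega>\<in>space M. xs \<omega> \<in> S_min)
            \<and> (AE \<omega> in M. (\<lambda>n. x n \<omega>) \<longlonglongrightarrow> xs \<omega>)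
            \<and> (\<forall>n. integrable M (\<lambda>\<omega>. wnorm (\<lambda>i. 1 / (\<gamma> i * p i)) (x n \<omega> - xs \<omega>)))
            \<and> (\<lambda>n. \<integral>\<omega>. wnorm (\<lambda>i. 1 / (\<gamma> i * p i)) (x n \<omega> - xs \<omega>) \<partial>M)
                \<in> O(\<lambda>n. rate powr (real n / 2)))"
proof -
  have step_sizes: "\<gamma> i * \<nu> i \<le> \<delta>" "\<delta> < 2" for i
    unfolding \<delta>_def using \<gamma>(2) \<nu>_pos by (auto simp: pos_less_divide_eq)
  have p_eq: "p i = measure M {\<omega> \<in> space M. \<epsilon> \<omega> i}" for i
    by (simp add: p_def)
  have p_min: "0 < p_min" "p_min \<le> p i" for i
    unfolding p_min_def using \<epsilon>(2) by auto
  have x_Suc_update: "x (Suc n) \<omega> = block_update V h grad \<gamma> (x n \<omega>) (eps n \<omega>)"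
    if "\<omega> \<in> space M" for n \<omega>
    using x_Suc[OF that] by (simp add: vec_eq_iff block_update_def block_select_def fb_step_def)
  interpret prob_space M by (rule M)
  interpret iteration: random_forward_backward V f grad h \<gamma> \<nu> \<delta> M \<epsilon> p p_min x0 eps x X c
    using V f_convex f_gradient(2) h \<gamma>(1) step_sizes \<epsilon>(1) p_eq p_min smooth eps_indep eps_copies
      x0 x_0 x_Suc_update S_min X(2) c error_bound
    unfolding H_def F_def S_min_def by unfold_locales
  have "rate = iteration.rate"
    by (simp only: rate_def iteration.rate_def)
  then show ?thesis
    unfolding F_def F_min_def S_min_def H_def
    using iteration.objective_linear_rate iteration.iterates_linear_rate by simp
qed

end
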